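(* Let $\Theta_0,\Theta_1$ be minimal L-systems (input-output space $\mathbb C$, $J=1$) satisfying Hypothesis I, and let $\Theta=\Theta_0\cdot\Theta_1$ be their coupling. Suppose that $V_{\Theta_0}\in\mathfrak M$ and $V_{\Theta_1}\in\mathfrak M_\kappa$ for some $0\le\kappa<1$. Then $V_\Theta\in\mathfrak M$.
   Context: L-systems. Let $\dot A$ be a closed, densely defined symmetric operator with deficiency indices $(1,1)$ in a Hilbert space $\mathcal H$. Let $\mathcal H_+=\mathrm{Dom}(\dot A^* )$ with inner product $(f,g)_+=(f,g)+(\dot A^*f,\dot A^*g)$, and let $\mathcal H_+\subset\mathcal H\subset\mathcal H_-$ be the associated rigged Hilbert space ($\mathcal H_-$ is the dual of $\mathcal H_+$ with respect to the pairing extending the inner product of $\mathcal H$). For a bounded $\mathbb A:\mathcal H_+\to\mathcal H_-$ the adjoint $\mathbb A^*$ is again bounded $\mathcal H_+\to\mathcal H_-$; $\mathrm{Re}\,\mathbb A=(\mathbb A+\mathbb A^* )/2$, $\mathrm{Im}\,\mathbb A=(\mathbb A-\mathbb A^* )/(2i)$. An operator $T$ with $\dot A\subset T\subset\dot A^*$ belongs to $\Lambda(\dot A)$ if $\rho(T)\neq\emptyset$ and $\mathrm{Dom}(\dot A)=\mathrm{Dom}(T)\cap\mathrm{Dom}(T^* )$. A bounded $\mathbb A:\mathcal H_+\to\mathcal H_-$ is a $( * )$-extension of $T$ if $\mathbb A\supset T\supset\dot A$, $\mathbb A^*\supset T^*\supset\dot A$, and the quasi-kernel $\hat A$ of $\mathrm{Re}\,\mathbb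 A$ (the restriction of $\mathrm{Re}\,\mathbb A$ to $\{f\in\mathcal H_+:\mathrm{Re}\,\mathbb A f\in\mathcal H\}$) is self-adjoint in $\mathcal H$. An L-system is an array $\Theta=\begin{pmatrix}\mathbb A&K&1\\ \mathcal H_+\subset\mathcal H\subset\mathcal H_-&&\mathbb C\end{pmatrix}$, where $\mathbb A$ is a $( * )$-extension of some $T\in\Lambda(\dot A)$ (the main operator), $K:\mathbb C\to\mathcal H_-$ is bounded with adjoint $K^*:\mathcal H_+\to\mathbb C$, $\mathrm{Im}\,\mathbb A=KK^*$, $\mathrm{Ran}(K)=\mathrm{Ran}(\mathrm{Im}\,\mathbb A)$. It is minimal if $\dot A$ is prime (no nontrivial reducing subspace on which $\dot A$ induces a self-adjoint operator). Impedance function: $V_\Theta(z)=K^*(\mathrm{Re}\,\mathbb A-zI)^{-1}K$, $z\in\rho(\hat A)$ (well defined). Hypothesis I for an L-system: there are $g_\pm\in\ker(\dot A^*\mp iI)$, $\|g_\pm\|=1$, with $g_+-g_-\in\mathrm{Dom}(\hat A)$ and $g_+-\kappa g_-\in\mathrm{Dom}(T)$ for some $0\le\kappa<1$ ($T\neq T^*$ is then a maximal dissipative extension of $\dot A$). The number $\kappa$ is the von Neumann parameter of $T$. Class $\mathfrak M_\kappa$ ($0\le\kappa<1$): all analytic $M:\mathbb C_+\to\mathbb C_+$ of the form $M(z)=\int_{\mathbb R}\left(\frac1{\lambda-z}-\frac{\lambda}{1+\lambda^2}\right)d\mu(\lambda)$ with $\mu$ an infinite Borel measure with $\int_{\mathbb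 R}\frac{d\mu(\lambda)}{1+\lambda^2}=\frac{1-\kappa}{1+\kappa}$ (equivalently $M(i)=i\frac{1-\kappa}{1+\kappa}$). The Donoghue class is $\mathfrak M=\mathfrak M_0$. Coupling of two L-systems (written for an ordered pair $\Theta_1,\Theta_2$; here it is applied to the ordered pair $\Theta_0,\Theta_1$). For $k=1,2$ let $\Theta_k$ act in $\mathcal H_k$, with symmetric operator $\dot A_k$, main operator $T_k$, and $g^k_\pm,\kappa_k$ as in Hypothesis I. Define $\alpha\in(0,\pi/2]$ by $\tan\alpha=\frac1{\kappa_2}\sqrt{\frac{1-\kappa_2^2}{1-\kappa_1^2}}$ if $\kappa_2\ne0$ and $\alpha=\pi/2$ if $\kappa_2=0$; define $\beta$ by $\sin\beta=\kappa_1\sin\alpha$, $\cos\beta=\frac1{\kappa_2}\cos\alpha$ if $\kappa_2\neq0$, and $\sin\beta=\kappa_1$, $\cos\beta=\sqrt{1-\kappa_1^2}$ if $\kappa_2=0$. Let $\dot A$ be the restriction of $(\dot A_1\oplus\dot A_2)^*$ to $\mathrm{Dom}(\dot A_1\oplus\dot A_2)\dot+\mathcal L_0$, where $\mathcal L_0$ is spanned by $\sin\alpha\,(g_+^1-\kappa_1g_-^1)\oplus\cos\alpha\,(g_+^2-\frac1{\kappa_2}g_-^2)$ if $\kappa_2\ne0$, and by $(g_+^1-\kappa_1g_-^1)\oplus(-\sqrt{1-\kappa_1^2}\,g_-^2)$ if $\kappa_2=0$. Then $\dot A$ is symmetric with deficiency indices $(1,1)$ in $\mathcal H_1\oplus\mathcal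 H_2$, with normalized deficiency vectors $G_+=\cos\alpha\,g_+^1-\sin\alpha\,g_+^2\in\ker(\dot A^*-iI)$ and $G_-=\cos\beta\,g_-^1-\sin\beta\,g_-^2\in\ker(\dot A^*+iI)$. The operator coupling $T=T_1\uplus T_2$ is the restriction of $(\dot A_1\oplus\dot A_2)^*$ to $\mathrm{Dom}(\dot A)\dot+\mathrm{span}\{G_+-\kappa_1\kappa_2G_-\}$, a maximal dissipative extension of $\dot A$. The coupling $\Theta_1\cdot\Theta_2$ is the L-system with symmetric operator $\dot A$, main operator $T$, rigging $\mathcal H_+=\mathrm{Dom}(\dot A^* )\subset\mathcal H_1\oplus\mathcal H_2\subset\mathcal H_-$, state-space operator $\mathbb A$ the (unique) $( * )$-extension of $T$ such that the quasi-kernel of $\mathrm{Re}\,\mathbb A$ is the self-adjoint extension $\hat A$ of $\dot A$ with $G_+-G_-\in\mathrm{Dom}(\hat A)$, and $Kc=c\chi$ with $\mathrm{Im}\,\mathbb A=(\cdot,\chi)\chi$ ($\chi$ is determined up to a unimodular factor). *)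

theory Defs
  imports "HOL-Analysis.Analysis"
begin

section \<open>Complex Hilbert spaces\<close>

text \<open>
  The inner product \<open>cinner\<close> is linear in its \<^emph>\<open>first\<close> argument and conjugate-linear in the
  second; the real inner product of the class \<^class>\<open>real_inner\<close> is its real part, so norm,
  topology and completeness are those of the library.
\<close>

class complex_vector = real_vector +
  fixes scaleC :: "complex \<Rightarrow> 'a \<Rightarrow> 'a" (infixr "*\<^sub>C" 75)
  assumes scaleC_add_right: "c *\<^sub>C (x + y) = c *\<^sub>C x + c *\<^sub>C y"
    and scaleC_add_left: "(c + d) *\<^sub>C x = c *\<^sub>C x + d *\<^sub>C x"
    and scaleC_scaleC: "c *\<^sub>C d *\<^sub>C x = (c * d) *\<^sub>C x"
    and scaleR_scaleC: "scaleR r x = complex_of_real r *\<^sub>C x"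

class complex_inner = complex_vector + real_inner +
  fixes cinner :: "'a \<Rightarrow> 'a \<Rightarrow> complex"
  assumes cinner_commute: "cinner x y = cnj (cinner y x)"
    and cinner_add_left: "cinner (x + y) z = cinner x z + cinner y z"
    and cinner_scaleC_left: "cinner (c *\<^sub>C x) y = c * cinner x y"
    and inner_eq_Re_cinner: "inner x y = Re (cinner x y)"

class chilbert_space = complex_inner + complete_space

global_interpretation complex_vector:
  vector_space "scaleC :: complex \<Rightarrow> 'a \<Rightarrow> 'a::complex_vector"
  defines csubspace = complex_vector.subspace
    and cspan = complex_vector.span
    and cdim = complex_vector.dim
proof
  fix a b :: complex and x y :: 'a
  show "a *\<^sub>C (x + y) = a *\<^sub>C x + a *\<^sub>C y" by (rule scaleC_add_right)
  show "(a + b) *\<^sub>C x = a *\<^sub>C x + b *\<^sub>C x" by (rule scaleC_add_left)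
  show "a *\<^sub>C b *\<^sub>C x = (a * b) *\<^sub>C x" by (rule scaleC_scaleC)
  show "1 *\<^sub>C x = x" using scaleR_scaleC[of 1 x] by simp
qed

text \<open>The product type is the Hilbert space direct sum.\<close>

instantiation prod :: (complex_vector, complex_vector) complex_vector
begin
definition "c *\<^sub>C p = (c *\<^sub>C fst p, c *\<^sub>C snd p)"
instance
  by standard
    (auto simp: scaleC_prod_def scaleC_add_right scaleC_add_left scaleC_scaleC scaleR_scaleC
      prod_eq_iff)
end

instantiation prod :: (complex_inner, complex_inner) complex_inner
begin
definition "cinner p q = cinner (fst p) (fst q) + cinner (snd p) (snd q)"
instance
proof
  fix p q r :: "'a \<times> 'b" and c :: complex
  show "cinner p q = cnj (cinner q p)"
    using cinner_commute[of "fst p" "fst q"] cinner_commute[of "snd p" "snd q"]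
    by (simp add: cinner_prod_def)
  show "cinner (p + q) r = cinner p r + cinner q r"
    by (simp add: cinner_prod_def cinner_add_left)
  show "cinner (c *\<^sub>C p) q = c * cinner p q"
    by (simp add: cinner_prod_def scaleC_prod_def cinner_scaleC_left algebra_simps)
  show "inner p q = Re (cinner p q)"
    by (simp add: cinner_prod_def inner_prod_def inner_eq_Re_cinner)
qed
end

instance prod :: (chilbert_space, chilbert_space) chilbert_space ..


section \<open>Unbounded operators\<close>

text \<open>
  An operator in a Hilbert space is represented by its graph, so that \<open>\<subseteq>\<close> is extension of
  operators and \<^const>\<open>Domain\<close> is the domain.
\<close>

type_synonym 'a operator = "('a \<times> 'a) set"

definition linear_operator :: "'a::chilbert_space operator \<Rightarrow> bool" where
  "linear_operator T \<longleftrightarrow> csubspace T \<and> single_valued T"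

definition op_apply :: "'a operator \<Rightarrow> 'a \<Rightarrow> 'a" where
  "op_apply T f = (THE f'. (f, f') \<in> T)"

definition op_restrict :: "'a operator \<Rightarrow> 'a set \<Rightarrow> 'a operator" where
  "op_restrict T D = {(f, f') \<in> T. f \<in> D}"

definition densely_defined :: "'a::chilbert_space operator \<Rightarrow> bool" where
  "densely_defined T \<longleftrightarrow> closure (Domain T) = UNIV"

definition adj :: "'a::chilbert_space operator \<Rightarrow> 'a operator" where
  "adj T = {(g, h). \<forall>(f, f') \<in> T. cinner f' g = cinner f h}"

definition symmetric_operator :: "'a::chilbert_space operator \<Rightarrow> bool" where
  "symmetric_operator T \<longleftrightarrow> linear_operator T \<and> densely_defined T \<and> T \<subseteq> adj T"

definition selfadjoint :: "'a::chilbert_space operator \<Rightarrow> bool" where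
  "selfadjoint T \<longleftrightarrow> linear_operator T \<and> densely_defined T \<and> adj T = T"

definition resolvent_set :: "'a::chilbert_space operator \<Rightarrow> complex set" where
  "resolvent_set T = {z.
     (\<forall>h. \<exists>!f. (f, h + z *\<^sub>C f) \<in> T) \<and>
     (\<exists>C. \<forall>(f, f') \<in> T. norm f \<le> C * norm (f' - z *\<^sub>C f))}"

definition op_ker :: "'a::chilbert_space operator \<Rightarrow> complex \<Rightarrow> 'a set" where
  "op_ker T z = {f. (f, z *\<^sub>C f) \<in> T}"  \<comment> \<open>kernel of \<open>T - zI\<close>\<close>

definition deficiency_indices_1_1 :: "'a::chilbert_space operator \<Rightarrow> bool" where
  "deficiency_indices_1_1 A \<longleftrightarrow>
     cdim (op_ker (adj A) \<i>) = 1 \<and> cdim (op_ker (adj A) (- \<i>)) = 1"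

definition orthogonal_complement :: "'a::chilbert_space set \<Rightarrow> 'a set" where
  "orthogonal_complement M = {f. \<forall>g\<in>M. cinner f g = 0}"

text \<open>
  A closed subspace \<open>M\<close> reduces \<open>A\<close> if \<open>A\<close> is the orthogonal sum of its parts in \<open>M\<close> and in the
  orthogonal complement of \<open>M\<close>, i.e. if the projection onto \<open>M \<times> M\<close> leaves the graph invariant.
\<close>

definition reducing_subspace :: "'a::chilbert_space operator \<Rightarrow> 'a set \<Rightarrow> bool" where
  "reducing_subspace A M \<longleftrightarrow> csubspace M \<and> closed M \<and>
     (\<forall>(f, f') \<in> A. \<exists>(g, g') \<in> A. g \<in> M \<and> g' \<in> M \<and>
        f - g \<in> orthogonal_complement M \<and> f' - g' \<in> orthogonal_complement M)"

text \<open>Self-adjointness, in the Hilbert space \<open>M\<close>, of the operator that \<open>A\<close> induces on \<open>M\<close>.\<close>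

definition selfadjoint_on :: "'a::chilbert_space operator \<Rightarrow> 'a set \<Rightarrow> bool" where
  "selfadjoint_on A M \<longleftrightarrow>
     M \<subseteq> closure (Domain (A \<inter> M \<times> M)) \<and> adj (A \<inter> M \<times> M) \<inter> M \<times> M = A \<inter> M \<times> M"

definition prime_operator :: "'a::chilbert_space operator \<Rightarrow> bool" where
  "prime_operator A \<longleftrightarrow>
     \<not> (\<exists>M. M \<noteq> {0} \<and> reducing_subspace A M \<and> selfadjoint_on A M)"


section \<open>The rigged Hilbert space of a symmetric operator\<close>

definition pos_space :: "'a::chilbert_space operator \<Rightarrow> 'a set" where
  "pos_space A = Domain (adj A)"

definition pos_inner :: "'a::chilbert_space operator \<Rightarrow> 'a \<Rightarrow> 'a \<Rightarrow> complex" where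
  "pos_inner A f g = cinner f g + cinner (op_apply (adj A) f) (op_apply (adj A) g)"

definition pos_norm :: "'a::chilbert_space operator \<Rightarrow> 'a \<Rightarrow> real" where
  "pos_norm A f = sqrt (Re (pos_inner A f f))"

text \<open>
  An element \<open>\<phi>\<close> of the negative space is represented by the bounded conjugate-linear functional
  \<open>g \<mapsto> (\<phi>, g)\<close> on the positive space, extended by 0 to the whole type so that equality of
  functionals is equality of functions; \<open>embed\<close> is the inclusion of the Hilbert space.
\<close>

type_synonym 'a functional = "'a \<Rightarrow> complex"

definition neg_space :: "'a::chilbert_space operator \<Rightarrow> 'a functional set" where
  "neg_space A = {\<phi>.
     (\<forall>f\<in>pos_space A. \<forall>g\<in>pos_space A. \<phi> (f + g) = \<phi> f + \<phi> g) \<and>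
     (\<forall>c. \<forall>f\<in>pos_space A. \<phi> (c *\<^sub>C f) = cnj c * \<phi> f) \<and>
     (\<exists>C. \<forall>f\<in>pos_space A. cmod (\<phi> f) \<le> C * pos_norm A f) \<and>
     (\<forall>f. f \<notin> pos_space A \<longrightarrow> \<phi> f = 0)}"

definition embed :: "'a::chilbert_space operator \<Rightarrow> 'a \<Rightarrow> 'a functional" where
  "embed A h = (\<lambda>g. if g \<in> pos_space A then cinner h g else 0)"

text \<open>
  Operators from the positive to the negative space; their values outside \<open>pos_space A\<close> are
  irrelevant. Boundedness is with respect to \<open>pos_norm\<close> and the dual norm.
\<close>

definition rig_bounded ::
    "'a::chilbert_space operator \<Rightarrow> ('a \<Rightarrow> 'a functional) \<Rightarrow> bool" where
  "rig_bounded A S \<longleftrightarrow>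
     (\<forall>f\<in>pos_space A. S f \<in> neg_space A) \<and>
     (\<forall>f\<in>pos_space A. \<forall>g\<in>pos_space A. S (f + g) = (\<lambda>h. S f h + S g h)) \<and>
     (\<forall>c. \<forall>f\<in>pos_space A. S (c *\<^sub>C f) = (\<lambda>h. c * S f h)) \<and>
     (\<exists>C. \<forall>f\<in>pos_space A. \<forall>g\<in>pos_space A. cmod (S f g) \<le> C * pos_norm A f * pos_norm A g)"

text \<open>The adjoint is determined by \<open>(S f, g) = (f, S\<^sup>* g)\<close>, i.e. \<open>S f g = cnj (S\<^sup>* g f)\<close>.\<close>

definition rig_adj ::
    "'a::chilbert_space operator \<Rightarrow> ('a \<Rightarrow> 'a functional) \<Rightarrow> 'a \<Rightarrow> 'a functional" where
  "rig_adj A S g = (\<lambda>f. if f \<in> pos_space A then cnj (S f g) else 0)"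

definition rig_Re ::
    "'a::chilbert_space operator \<Rightarrow> ('a \<Rightarrow> 'a functional) \<Rightarrow> 'a \<Rightarrow> 'a functional" where
  "rig_Re A S f = (\<lambda>g. (S f g + rig_adj A S f g) / 2)"

definition rig_Im ::
    "'a::chilbert_space operator \<Rightarrow> ('a \<Rightarrow> 'a functional) \<Rightarrow> 'a \<Rightarrow> 'a functional" where
  "rig_Im A S f = (\<lambda>g. (S f g - rig_adj A S f g) / (2 * \<i>))"

definition rig_extends ::
    "'a::chilbert_space operator \<Rightarrow> ('a \<Rightarrow> 'a functional) \<Rightarrow> 'a operator \<Rightarrow> bool" where
  "rig_extends A S T \<longleftrightarrow> (\<forall>(f, f') \<in> T. f \<in> pos_space A \<and> S f = embed A f')"

text \<open>The quasi-kernel of the real part of \<open>S\<close>.\<close>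

definition quasi_kernel ::
    "'a::chilbert_space operator \<Rightarrow> ('a \<Rightarrow> 'a functional) \<Rightarrow> 'a operator" where
  "quasi_kernel A S = {(f, h). f \<in> pos_space A \<and> rig_Re A S f = embed A h}"

definition Lambda_class :: "'a::chilbert_space operator \<Rightarrow> 'a operator set" where
  "Lambda_class A = {T. linear_operator T \<and> A \<subseteq> T \<and> T \<subseteq> adj A \<and>
     resolvent_set T \<noteq> {} \<and> Domain A = Domain T \<inter> Domain (adj T)}"

definition star_extension ::
    "'a::chilbert_space operator \<Rightarrow> 'a operator \<Rightarrow> ('a \<Rightarrow> 'a functional) \<Rightarrow> bool" where
  "star_extension A T S \<longleftrightarrow> rig_bounded A S \<and>
     rig_extends A S T \<and> A \<subseteq> T \<and>
     rig_extends A (rig_adj A S) (adj T) \<and> A \<subseteq> adj T \<and>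
     selfadjoint (quasi_kernel A S)"


section \<open>L-systems with input-output space \<open>\<complex>\<close> and \<open>J = 1\<close>\<close>

record 'a lsystem =
  sym_op :: "'a operator"
  main_op :: "'a operator"
  state_op :: "'a \<Rightarrow> 'a functional"
  channel_op :: "complex \<Rightarrow> 'a functional"

definition channel_bounded ::
    "'a::chilbert_space operator \<Rightarrow> (complex \<Rightarrow> 'a functional) \<Rightarrow> bool" where
  "channel_bounded A K \<longleftrightarrow>
     (\<forall>c. K c \<in> neg_space A) \<and>
     (\<forall>c d. K (c + d) = (\<lambda>g. K c g + K d g)) \<and>
     (\<forall>c d. K (c * d) = (\<lambda>g. c * K d g)) \<and>
     (\<exists>C. \<forall>c. \<forall>g\<in>pos_space A. cmod (K c g) \<le> C * cmod c * pos_norm A g)"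

text \<open>The adjoint satisfies \<open>(K c, f) = c * cnj (K\<^sup>* f)\<close>.\<close>

definition channel_adj :: "(complex \<Rightarrow> 'a functional) \<Rightarrow> 'a \<Rightarrow> complex" where
  "channel_adj K f = cnj (K 1 f)"

lemma channel_adj_adjoint:
  assumes "channel_bounded A K"
  shows "K c f = c * cnj (channel_adj K f)"
proof -
  have "K (c * 1) = (\<lambda>g. c * K 1 g)"
    using assms unfolding channel_bounded_def by blast
  then show ?thesis by (simp add: channel_adj_def)
qed

definition L_system :: "'a::chilbert_space lsystem \<Rightarrow> bool" where
  "L_system \<Theta> \<longleftrightarrow>
     symmetric_operator (sym_op \<Theta>) \<and> closed (sym_op \<Theta>) \<and>
     deficiency_indices_1_1 (sym_op \<Theta>) \<and>
     main_op \<Theta> \<in> Lambda_class (sym_op \<Theta>) \<and>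
     star_extension (sym_op \<Theta>) (main_op \<Theta>) (state_op \<Theta>) \<and>
     channel_bounded (sym_op \<Theta>) (channel_op \<Theta>) \<and>
     (\<forall>f\<in>pos_space (sym_op \<Theta>).
        rig_Im (sym_op \<Theta>) (state_op \<Theta>) f = channel_op \<Theta> (channel_adj (channel_op \<Theta>) f)) \<and>
     range (channel_op \<Theta>) = rig_Im (sym_op \<Theta>) (state_op \<Theta>) ` pos_space (sym_op \<Theta>)"

definition minimal_system :: "'a::chilbert_space lsystem \<Rightarrow> bool" where
  "minimal_system \<Theta> \<longleftrightarrow> prime_operator (sym_op \<Theta>)"

text \<open>
  \<open>the_inv_into\<close> below is the inverse of \<open>Re \<bbbA> - zI\<close>, as a map from the positive to the negative
  space; it is used for \<open>z\<close> in the resolvent set of the quasi-kernel, where that map is injective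
  and has the range of \<open>K\<close> in its range.
\<close>

definition impedance :: "'a::chilbert_space lsystem \<Rightarrow> complex \<Rightarrow> complex" where
  "impedance \<Theta> z =
     (let A = sym_op \<Theta>; S = state_op \<Theta>; K = channel_op \<Theta> in
      channel_adj K
        (the_inv_into (pos_space A) (\<lambda>f. (\<lambda>g. rig_Re A S f g - z * embed A f g)) (K 1)))"

text \<open>Hypothesis I, with its data \<open>g\<^sub>+\<close>, \<open>g\<^sub>-\<close> and the von Neumann parameter explicit.\<close>

definition hypothesis_I_data ::
    "'a::chilbert_space lsystem \<Rightarrow> 'a \<Rightarrow> 'a \<Rightarrow> real \<Rightarrow> bool" where
  "hypothesis_I_data \<Theta> gp gm \<kappa> \<longleftrightarrow>
     gp \<in> op_ker (adj (sym_op \<Theta>)) \<i> \<and> gm \<in> op_ker (adj (sym_op \<Theta>)) (- \<i>) \<and>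
     norm gp = 1 \<and> norm gm = 1 \<and>
     gp - gm \<in> Domain (quasi_kernel (sym_op \<Theta>) (state_op \<Theta>)) \<and>
     0 \<le> \<kappa> \<and> \<kappa> < 1 \<and> gp - \<kappa> *\<^sub>R gm \<in> Domain (main_op \<Theta>)"

definition hypothesis_I :: "'a::chilbert_space lsystem \<Rightarrow> bool" where
  "hypothesis_I \<Theta> \<longleftrightarrow> (\<exists>gp gm \<kappa>. hypothesis_I_data \<Theta> gp gm \<kappa>)"


section \<open>Coupling\<close>

definition op_sum ::
    "'a operator \<Rightarrow> 'b operator \<Rightarrow> ('a \<times> 'b) operator" where
  "op_sum A B = {((f, g), (f', g')) | f g f' g'. (f, f') \<in> A \<and> (g, g') \<in> B}"

text \<open>The subspace spanned by \<open>D\<close> and one further vector.\<close>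

definition add_span :: "'a::chilbert_space set \<Rightarrow> 'a \<Rightarrow> 'a set" where
  "add_span D v = {d + l | d l. d \<in> D \<and> l \<in> cspan {v}}"

definition coupling_angles :: "real \<Rightarrow> real \<Rightarrow> real \<Rightarrow> real \<Rightarrow> bool" where
  "coupling_angles \<kappa>1 \<kappa>2 \<alpha> \<beta> \<longleftrightarrow>
     0 < \<alpha> \<and> \<alpha> \<le> pi / 2 \<and>
     (if \<kappa>2 \<noteq> 0
      then tan \<alpha> = 1 / \<kappa>2 * sqrt ((1 - \<kappa>2\<^sup>2) / (1 - \<kappa>1\<^sup>2)) \<and>
           sin \<beta> = \<kappa>1 * sin \<alpha> \<and> cos \<beta> = 1 / \<kappa>2 * cos \<alpha>
      else \<alpha> = pi / 2 \<and> sin \<beta> = \<kappa>1 \<and> cos \<beta> = sqrt (1 - \<kappa>1\<^sup>2))"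

definition coupling_vector ::
    "real \<Rightarrow> real \<Rightarrow> real \<Rightarrow>
     'a::chilbert_space \<Rightarrow> 'a \<Rightarrow> 'b::chilbert_space \<Rightarrow> 'b \<Rightarrow> 'a \<times> 'b" where
  "coupling_vector \<kappa>1 \<kappa>2 \<alpha> gp1 gm1 gp2 gm2 =
     (if \<kappa>2 \<noteq> 0
      then (sin \<alpha> *\<^sub>R (gp1 - \<kappa>1 *\<^sub>R gm1), cos \<alpha> *\<^sub>R (gp2 - (1 / \<kappa>2) *\<^sub>R gm2))
      else (gp1 - \<kappa>1 *\<^sub>R gm1, - sqrt (1 - \<kappa>1\<^sup>2) *\<^sub>R gm2))"

text \<open>
  The coupling of two L-systems is fixed only up to the choice of the vectors in Hypothesis I and
  of a unimodular factor of the channel vector \<open>\<xi>\<close>, hence a relation.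
\<close>

definition is_coupling ::
    "'a::chilbert_space lsystem \<Rightarrow> 'b::chilbert_space lsystem \<Rightarrow> ('a \<times> 'b) lsystem \<Rightarrow> bool" where
  "is_coupling \<Theta>1 \<Theta>2 \<Theta> \<longleftrightarrow>
     (\<exists>gp1 gm1 \<kappa>1 gp2 gm2 \<kappa>2 \<alpha> \<beta> Gp Gm \<xi>.
        hypothesis_I_data \<Theta>1 gp1 gm1 \<kappa>1 \<and> hypothesis_I_data \<Theta>2 gp2 gm2 \<kappa>2 \<and>
        coupling_angles \<kappa>1 \<kappa>2 \<alpha> \<beta> \<and>
        Gp = (cos \<alpha> *\<^sub>R gp1, - sin \<alpha> *\<^sub>R gp2) \<and>
        Gm = (cos \<beta> *\<^sub>R gm1, - sin \<beta> *\<^sub>R gm2) \<and>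
        L_system \<Theta> \<and>
        sym_op \<Theta> =
          op_restrict (adj (op_sum (sym_op \<Theta>1) (sym_op \<Theta>2)))
            (add_span (Domain (op_sum (sym_op \<Theta>1) (sym_op \<Theta>2)))
              (coupling_vector \<kappa>1 \<kappa>2 \<alpha> gp1 gm1 gp2 gm2)) \<and>
        main_op \<Theta> =
          op_restrict (adj (op_sum (sym_op \<Theta>1) (sym_op \<Theta>2)))
            (add_span (Domain (sym_op \<Theta>)) (Gp - (\<kappa>1 * \<kappa>2) *\<^sub>R Gm)) \<and>
        Gp - Gm \<in> Domain (quasi_kernel (sym_op \<Theta>) (state_op \<Theta>)) \<and>
        \<xi> \<in> neg_space (sym_op \<Theta>) \<and>
        (\<forall>f\<in>pos_space (sym_op \<Theta>).
           rig_Im (sym_op \<Theta>) (state_op \<Theta>) f = (\<lambda>g. cnj (\<xi> f) * \<xi> g)) \<and>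
        channel_op \<Theta> = (\<lambda>c g. c * \<xi> g))"


section \<open>Donoghue classes\<close>

definition upper_half_plane :: "complex set" where
  "upper_half_plane = {z. Im z > 0}"

text \<open>
  Only the values of \<open>M\<close> on the upper half-plane matter. Integrability of the integrand follows
  from the finiteness of the integral of \<open>1 / (1 + \<lambda>\<^sup>2)\<close>.
\<close>

definition donoghue_class_kappa :: "real \<Rightarrow> (complex \<Rightarrow> complex) set" where
  "donoghue_class_kappa \<kappa> = {M.
     M analytic_on upper_half_plane \<and> M ` upper_half_plane \<subseteq> upper_half_plane \<and>
     (\<exists>\<mu> :: real measure.
        sets \<mu> = sets borel \<and> emeasure \<mu> UNIV = \<infinity> \<and>
        (\<integral>\<^sup>+ t. ennreal (1 / (1 + t\<^sup>2)) \<partial>\<mu>) = ennreal ((1 - \<kappa>) / (1 + \<kappa>)) \<and>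
        (\<forall>z\<in>upper_half_plane.
           M z = (\<integral>t. 1 / (complex_of_real t - z) - complex_of_real (t / (1 + t\<^sup>2)) \<partial>\<mu>)))}"

definition donoghue_class :: "(complex \<Rightarrow> complex) set" where
  "donoghue_class = donoghue_class_kappa 0"

end

(*
  Let Q be the quasi-kernel of the real part of the state-space operator. Hypothesis I alone
  determines the channel vector on g_+ and on Dom(Q), and solving (Re A - z) f = K 1 with
  f proportional to g_+ + (z - i) (Q - z)^{-1} g_+ gives, with von Neumann parameter kappa,

    V(z) = (1 - kappa) / (1 + kappa) * (z + (z^2 + 1) ((Q - z)^{-1} g_+, g_+)).

  At z = i this shows that the first system has parameter 0. The parameter of the coupling is
  the product of the two parameters, hence 0 as well, so it remains to see that
  z + (z^2 + 1) ((Q - z)^{-1} g_+, g_+) belongs to the Donoghue class. Let U be the Cayley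
  transform of Q and c_n = (U^n g_+, g_+). In the variable w = (z - i) / (z + i) this function is
  i (1 + 2 sum_{n >= 1} c_n w^n). Fejer means and Helly selection give a probability measure with
  moments c_n, and the substitution t = cot (s / 2) turns it into the measure required. It has no
  atom at the point s = 0 corresponding to infinity since Q is densely defined. Its image has
  infinite mass because otherwise the boundary form (Q f, g_+) - (f, i g_+), which vanishes on the
  dense domain of the symmetric operator, would be bounded on Dom(Q), hence zero.
*)
theory Submission
  imports Defs "HOL-Probability.Levy"
begin

section \<open>Complex Hilbert spaces\<close>

text \<open>Only one vector and nonnegative powers of U are used. Surjectivity of Q - i already
  makes U everywhere defined and isometric, and the Toeplitz structure of the Gram matrix of the U^n
  g_+ replaces the spectral theorem. With k = (1 - w U)^{-1} g_+, all that is needed of the measure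
  are the integrals of 1 / (1 - w exp(is)) and, for real w = r, of 1 / |1 - r exp(is)|^2. They equal
  (k, g_+) and the squared norm of k. Both delicate properties, no mass at infinity and infinite
  total mass, are read off from this norm as r tends to 1.

  The vector solving (Re A - z) f = K 1 arises because (Re A - i) g_+ is a multiple of K 1; adding
  (z - i) h with (Q - z) h = g_+ replaces i by z. Two things have to cancel: the channel vector has
  an undetermined phase, so its values are computed relative to its value at g_+ - \<kappa> g_-, and
  g_+ and g_- need not be orthogonal in H. Moreover, a coupling comes with some unspecified data of
  Hypothesis I, so the parameters of its factors must be recovered from the impedance
  functions.\<close>

instance chilbert_space \<subseteq> banach ..

lemma cinner_add_right: "cinner x (y + z) = cinner x y + cinner x z"
  for x :: "'a::complex_inner"
  by (metis cinner_add_left cinner_commute complex_cnj_add)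

lemma cinner_scaleC_right: "cinner x (c *\<^sub>C y) = cnj c * cinner x y"
  for x :: "'a::complex_inner"
  by (metis cinner_scaleC_left cinner_commute complex_cnj_mult)

lemma cinner_zero_left [simp]: "cinner 0 x = 0" for x :: "'a::complex_inner"
  using cinner_add_left[of 0 0 x] by simp

lemma cinner_zero_right [simp]: "cinner x 0 = 0" for x :: "'a::complex_inner"
  using cinner_add_right[of x 0 0] by simp

lemma cinner_minus_left [simp]: "cinner (- x) y = - cinner x y" for x :: "'a::complex_inner"
  using cinner_add_left[of x "- x" y] by (simp add: eq_neg_iff_add_eq_0 add.commute)

lemma cinner_minus_right [simp]: "cinner x (- y) = - cinner x y" for x :: "'a::complex_inner"
  using cinner_add_right[of x y "- y"] by (simp add: eq_neg_iff_add_eq_0 add.commute)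

lemma cinner_diff_left: "cinner (x - y) z = cinner x z - cinner y z" for x :: "'a::complex_inner"
  using cinner_add_left[of x "- y" z] by simp

lemma cinner_diff_right: "cinner x (y - z) = cinner x y - cinner x z" for x :: "'a::complex_inner"
  using cinner_add_right[of x y "- z"] by simp

lemma cinner_scaleR_left: "cinner (r *\<^sub>R x) y = r * cinner x y" for x :: "'a::complex_inner"
  by (simp add: scaleR_scaleC cinner_scaleC_left)

lemma cinner_scaleR_right: "cinner x (r *\<^sub>R y) = r * cinner x y" for x :: "'a::complex_inner"
  by (simp add: scaleR_scaleC cinner_scaleC_right)

lemmas cinner_linear = cinner_add_left cinner_add_right cinner_diff_left cinner_diff_right
  cinner_scaleC_left cinner_scaleC_right cinner_scaleR_left cinner_scaleR_right

lemma cinner_sum_left: "cinner (sum f I) y = (\<Sum>i\<in>I. cinner (f i) y)"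
  for y :: "'a::complex_inner"
  by (induction I rule: infinite_finite_induct) (auto simp: cinner_add_left)

lemma cinner_sum_right: "cinner y (sum f I) = (\<Sum>i\<in>I. cinner y (f i))"
  for y :: "'a::complex_inner"
  by (induction I rule: infinite_finite_induct) (auto simp: cinner_add_right)

lemma cinner_self: "cinner x x = complex_of_real ((norm x)\<^sup>2)" for x :: "'a::complex_inner"
proof -
  have "Im (cinner x x) = 0"
    using arg_cong[OF cinner_commute[of x x], of Im] by simp
  then show ?thesis
    by (simp add: complex_eq_iff power2_norm_eq_inner inner_eq_Re_cinner)
qed

lemma norm_scaleC: "norm (c *\<^sub>C x) = cmod c * norm x" for x :: "'a::complex_inner"
proof -
  have "complex_of_real ((norm (c *\<^sub>C x))\<^sup>2) = c * (cnj c * complex_of_real ((norm x)\<^sup>2))"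
    unfolding cinner_self[symmetric] by (simp only: cinner_scaleC_left cinner_scaleC_right mult.left_commute)
  also have "\<dots> = complex_of_real ((cmod c * norm x)\<^sup>2)"
    by (simp add: power_mult_distrib complex_norm_square[symmetric] mult.assoc[symmetric] del: of_real_power)
  finally have "(norm (c *\<^sub>C x))\<^sup>2 = (cmod c * norm x)\<^sup>2"
    using of_real_eq_iff by blast
  then show ?thesis
    by (rule power2_eq_imp_eq) auto
qed

lemma cmod_cinner_le: "cmod (cinner x y) \<le> norm x * norm y" for x :: "'a::complex_inner"
proof (cases "cinner x y = 0")
  case False
  \<comment> \<open>Multiplying x by this phase makes the inner product real and nonnegative, where
    it coincides with \<open>inner\<close> and the real Cauchy-Schwarz inequality applies.\<close>
  define c where "c = cnj (sgn (cinner x y))"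
  have c: "cmod c = 1"
    using False by (simp add: c_def norm_sgn)
  have "c * cinner x y = cmod (cinner x y)"
    using False complex_norm_square[of "cinner x y"]
    by (simp add: c_def sgn_eq field_simps power2_eq_square)
  then have "cmod (cinner x y) = inner (c *\<^sub>C x) y"
    by (simp add: inner_eq_Re_cinner cinner_scaleC_left)
  also have "\<dots> \<le> norm (c *\<^sub>C x) * norm y"
    by (rule norm_cauchy_schwarz)
  finally show ?thesis
    by (simp add: norm_scaleC c)
qed simp

lemma bounded_linear_cinner_left: "bounded_linear (\<lambda>x. cinner x y)" for y :: "'a::complex_inner"
  by (rule bounded_linear_intro[of _ "norm y"])
    (auto simp: cinner_linear cmod_cinner_le scaleR_conv_of_real)

lemma bounded_linear_scaleC: "bounded_linear (\<lambda>x::'a::complex_inner. c *\<^sub>C x)"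
proof (rule bounded_linear_intro[of _ "cmod c"])
  show "c *\<^sub>C (r *\<^sub>R x) = r *\<^sub>R c *\<^sub>C x" for r and x :: 'a
    by (simp add: scaleR_scaleC scaleC_scaleC mult.commute)
qed (auto simp: scaleC_add_right norm_scaleC mult.commute[of _ "cmod c"])

lemma bounded_linear_cinner_right: "bounded_linear (\<lambda>y. cinner x y)" for x :: "'a::complex_inner"
  by (rule bounded_linear_intro[of _ "norm x"])
    (auto simp: cinner_linear scaleR_conv_of_real mult.commute[of "norm _" "norm x"] cmod_cinner_le)

lemmas tendsto_cinner_left = bounded_linear.tendsto[OF bounded_linear_cinner_left]
lemmas tendsto_cinner_right = bounded_linear.tendsto[OF bounded_linear_cinner_right]
lemmas tendsto_scaleC = bounded_linear.tendsto[OF bounded_linear_scaleC]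

lemma norm_add_scaleC_square:
  "(norm (x + c *\<^sub>C y))\<^sup>2 = (norm x)\<^sup>2 + (cmod c * norm y)\<^sup>2 + 2 * Re (cnj c * cinner x y)"
  for x :: "'a::complex_inner"
  by (simp add: power2_norm_eq_inner[of "x + c *\<^sub>C y"] inner_add_left inner_add_right
      inner_commute[of "c *\<^sub>C y" x])
    (simp add: norm_scaleC[symmetric] power2_norm_eq_inner inner_eq_Re_cinner cinner_scaleC_right)

text \<open>The minimizing sequence of the distance from \<open>x\<close> to \<open>S\<close> is Cauchy by the parallelogram law.\<close>

lemma closed_csubspace_projection:
  fixes S :: "'a::chilbert_space set"
  assumes S: "csubspace S" and "closed S"
  obtains p where "p \<in> S" "\<And>y. y \<in> S \<Longrightarrow> cinner (x - p) y = 0"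
proof -
  have Sadd: "u + v \<in> S" and Sscale: "c *\<^sub>C u \<in> S" if "u \<in> S" "v \<in> S" for u v c
    using S that complex_vector.subspace_add complex_vector.subspace_scale by blast+
  have S0: "0 \<in> S"
    using S complex_vector.subspace_0 by blast
  define d where "d = (INF y\<in>S. norm (x - y))"
  have bdd: "bdd_below ((\<lambda>y. norm (x - y)) ` S)"
    by (rule bdd_belowI2[of _ 0]) simp
  have d_le: "d \<le> norm (x - y)" if "y \<in> S" for y
    unfolding d_def using that bdd by (rule cINF_lower[rotated])
  have d0: "0 \<le> d"
    unfolding d_def using S0 by (intro cINF_greatest) auto
  have "\<exists>y\<in>S. norm (x - y) < d + 1 / Suc n" for n
  proof -
    have "d < d + 1 / Suc n" by simp
    then show ?thesis
      unfolding d_def using S0 bdd by (subst (asm) cINF_less_iff) auto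
  qed
  then obtain y where yS: "y n \<in> S" and y: "norm (x - y n) < d + 1 / Suc n" for n
    by metis
  have norm_lim: "(\<lambda>n. norm (x - y n)) \<longlonglongrightarrow> d"
  proof (rule tendsto_sandwich[where f = "\<lambda>_. d"])
    show "(\<lambda>n. d + 1 / Suc n) \<longlonglongrightarrow> d"
      using tendsto_add[OF tendsto_const LIMSEQ_inverse_real_of_nat, of d]
      by (simp add: inverse_eq_divide)
  qed (use d_le[OF yS] less_imp_le[OF y] in \<open>auto simp del: of_nat_Suc\<close>)
  have par: "(norm (y m - y n))\<^sup>2 \<le> 2 * ((norm (x - y m))\<^sup>2 - d\<^sup>2) + 2 * ((norm (x - y n))\<^sup>2 - d\<^sup>2)" for m n
  proof -
    have mid: "(1/2) *\<^sub>C (y m + y n) \<in> S"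
      using yS Sadd Sscale by blast
    have "d\<^sup>2 \<le> (norm (x - (1/2) *\<^sub>C (y m + y n)))\<^sup>2"
      using d_le[OF mid] d0 by (rule power_mono)
    moreover have "(1/2) *\<^sub>C (y m + y n) = (1/2) *\<^sub>R (y m + y n)"
      by (simp add: scaleR_scaleC)
    ultimately have "d\<^sup>2 \<le> (norm (x - (1/2) *\<^sub>R (y m + y n)))\<^sup>2"
      by simp
    moreover have "(norm (y m - y n))\<^sup>2 + 4 * (norm (x - (1/2) *\<^sub>R (y m + y n)))\<^sup>2
        = 2 * (norm (x - y m))\<^sup>2 + 2 * (norm (x - y n))\<^sup>2"
      unfolding power2_norm_eq_inner
      by (simp add: inner_diff_left inner_diff_right inner_add_left inner_add_right
          inner_commute algebra_simps)
    ultimately show ?thesis by simp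
  qed
  have "Cauchy y"
  proof (rule metric_CauchyI)
    fix e :: real assume e: "0 < e"
    have "(\<lambda>n. (norm (x - y n))\<^sup>2) \<longlonglongrightarrow> d\<^sup>2"
      by (intro tendsto_power norm_lim)
    then have "eventually (\<lambda>n. (norm (x - y n))\<^sup>2 < d\<^sup>2 + e\<^sup>2/4) sequentially"
      by (rule order_tendstoD) (use e in simp)
    then obtain N where N: "\<And>n. n \<ge> N \<Longrightarrow> (norm (x - y n))\<^sup>2 < d\<^sup>2 + e\<^sup>2/4"
      by (auto simp: eventually_at_top_linorder)
    show "\<exists>N. \<forall>m\<ge>N. \<forall>n\<ge>N. dist (y m) (y n) < e"
    proof (intro exI[of _ N] allI impI)
      fix m n assume mn: "N \<le> m" "N \<le> n"
      have "(norm (y m - y n))\<^sup>2 < e\<^sup>2"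
      proof -
        have "2 * ((norm (x - y m))\<^sup>2 - d\<^sup>2) < e\<^sup>2 / 2" "2 * ((norm (x - y n))\<^sup>2 - d\<^sup>2) < e\<^sup>2 / 2"
          using N[OF mn(1)] N[OF mn(2)] by simp_all
        with par[of m n] show ?thesis by simp
      qed
      then show "dist (y m) (y n) < e"
        using e by (simp add: dist_norm power_less_imp_less_base)
    qed
  qed
  then obtain p where p: "y \<longlonglongrightarrow> p"
    using Cauchy_convergent_iff convergent_def by blast
  have pS: "p \<in> S"
    using closed_sequentially[OF \<open>closed S\<close>] p yS by blast
  have "(\<lambda>n. norm (x - y n)) \<longlonglongrightarrow> norm (x - p)"
    by (intro tendsto_intros p)
  then have np: "norm (x - p) = d"
    using norm_lim LIMSEQ_unique by blast
  have "cinner (x - p) v = 0" if v: "v \<in> S" for v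
  proof (cases "v = 0")
    case False
    \<comment> \<open>The coefficient minimising the norm of \<open>x - p + c *\<^sub>C v\<close>.
      It lowers the squared distance by \<open>(cmod c * norm v)\<^sup>2\<close>, which minimality
      of d permits only for c = 0.\<close>
    define c where "c = - cinner (x - p) v / (norm v)\<^sup>2"
    have "p - c *\<^sub>C v \<in> S"
      using Sadd[OF pS Sscale[OF v v, of "- c"]] by simp
    then have "d\<^sup>2 \<le> (norm (x - (p - c *\<^sub>C v)))\<^sup>2"
      using d_le d0 by (intro power_mono) auto
    also have "\<dots> = (norm (x - p + c *\<^sub>C v))\<^sup>2"
      by (simp add: algebra_simps)
    also have "\<dots> = d\<^sup>2 + (cmod c * norm v)\<^sup>2 + 2 * Re (cnj c * cinner (x - p) v)"
      by (simp add: norm_add_scaleC_square np)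
    also have "cnj c * cinner (x - p) v = - complex_of_real ((cmod c * norm v)\<^sup>2)"
    proof -
      have "cinner (x - p) v = - c * (norm v)\<^sup>2"
        using False by (simp add: c_def)
      then show ?thesis
        using complex_norm_square[of c] by (simp add: power_mult_distrib algebra_simps)
    qed
    finally have "(cmod c * norm v)\<^sup>2 \<le> 0"
      by simp
    then have "c = 0"
      using False by simp
    then show ?thesis
      using False by (simp add: c_def)
  qed simp
  with pS show thesis by (rule that)
qed

lemma closed_csubspace_eq_UNIV:
  fixes S :: "'a::chilbert_space set"
  assumes "csubspace S" "closed S" "orthogonal_complement S \<subseteq> {0}"
  shows "S = UNIV"
proof -
  have "x \<in> S" for x
  proof -
    obtain p where p: "p \<in> S" "\<And>y. y \<in> S \<Longrightarrow> cinner (x - p) y = 0"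
      using closed_csubspace_projection[OF assms(1,2)] by blast
    then have "x - p \<in> {0}"
      using assms(3) unfolding orthogonal_complement_def by blast
    with p show ?thesis by simp
  qed
  then show ?thesis by blast
qed

section \<open>Self-adjoint operators\<close>

lemma linear_operator_add:
  "linear_operator T \<Longrightarrow> (f, f') \<in> T \<Longrightarrow> (g, g') \<in> T \<Longrightarrow> (f + g, f' + g') \<in> T"
  using complex_vector.subspace_add[of T "(f, f')" "(g, g')"] by (simp add: linear_operator_def)

lemma linear_operator_scaleC: "linear_operator T \<Longrightarrow> (f, f') \<in> T \<Longrightarrow> (c *\<^sub>C f, c *\<^sub>C f') \<in> T"
  using complex_vector.subspace_scale[of T "(f, f')" c]
  by (simp add: linear_operator_def scaleC_prod_def)

lemma linear_operator_diff:
  "linear_operator T \<Longrightarrow> (f, f') \<in> T \<Longrightarrow> (g, g') \<in> T \<Longrightarrow> (f - g, f' - g') \<in> T"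
  using complex_vector.subspace_diff[of T "(f, f')" "(g, g')"] by (simp add: linear_operator_def)

lemma linear_operator_unique:
  "linear_operator T \<Longrightarrow> (f, f') \<in> T \<Longrightarrow> (f, f'') \<in> T \<Longrightarrow> f' = f''"
  by (simp add: linear_operator_def single_valued_def)

lemma adjD: "(g, h) \<in> adj T \<Longrightarrow> (f, f') \<in> T \<Longrightarrow> cinner f' g = cinner f h"
  by (auto simp: adj_def)

lemma adj_antimono: "S \<subseteq> T \<Longrightarrow> adj T \<subseteq> adj S"
  by (auto simp: adj_def)

lemma densely_defined_orthogonal:
  assumes "densely_defined T" "\<And>f. f \<in> Domain T \<Longrightarrow> cinner f x = 0"
  shows "x = 0"
proof -
  have "x \<in> closure (Domain T)"
    using assms(1) by (simp add: densely_defined_def)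
  then obtain f where f: "\<And>n. f n \<in> Domain T" "f \<longlonglongrightarrow> x"
    unfolding closure_sequential by blast
  have "(\<lambda>n. cinner (f n) x) \<longlonglongrightarrow> cinner x x"
    by (rule tendsto_cinner_left[OF f(2)])
  then have "cinner x x = 0"
    using assms(2)[OF f(1)] by (simp add: LIMSEQ_const_iff)
  then show ?thesis
    by (simp add: cinner_self)
qed

lemma linear_operator_adj:
  assumes "densely_defined T"
  shows "linear_operator (adj T)"
  unfolding linear_operator_def
proof
  show "csubspace (adj T)"
    by (rule complex_vector.subspaceI)
      (auto simp: adj_def scaleC_prod_def cinner_linear zero_prod_def split_beta)
  show "single_valued (adj T)"
  proof (rule single_valuedI)
    fix g h k assume *: "(g, h) \<in> adj T" "(g, k) \<in> adj T"
    have "cinner f (h - k) = 0" if f: "f \<in> Domain T" for f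
    proof -
      obtain f' where "(f, f') \<in> T"
        using f by blast
      then show ?thesis
        using adjD[OF *(1)] adjD[OF *(2)] by (simp add: cinner_diff_right)
    qed
    then have "h - k = 0"
      by (rule densely_defined_orthogonal[OF assms])
    then show "h = k" by simp
  qed
qed

context
  fixes A :: "'a::chilbert_space operator"
  assumes sa: "selfadjoint A"
begin

lemma selfadjoint_linear: "linear_operator A"
  using sa by (simp add: selfadjoint_def)

lemma selfadjointD: "(f, f') \<in> A \<Longrightarrow> (g, g') \<in> A \<Longrightarrow> cinner f' g = cinner f g'"
  using sa adjD[of g g' A] by (simp add: selfadjoint_def)

lemma selfadjointI: "(\<And>f f'. (f, f') \<in> A \<Longrightarrow> cinner f' g = cinner f h) \<Longrightarrow> (g, h) \<in> A"
  using sa by (auto simp: selfadjoint_def adj_def)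

lemma selfadjoint_eigenvector_zero:
  assumes "(f, z *\<^sub>C f) \<in> A" "Im z \<noteq> 0"
  shows "f = 0"
proof -
  have "(z - cnj z) * cinner f f = 0"
    using selfadjointD[OF assms(1) assms(1)] by (simp add: cinner_linear algebra_simps)
  moreover have "z - cnj z \<noteq> 0"
    using assms(2) by (simp add: complex_eq_iff)
  ultimately show ?thesis
    by (simp add: cinner_self)
qed

text \<open>As \<open>cinner f' f\<close> is real, the cross term has real part 0. Both signs thus
  give the same norm, which makes the Cayley transform isometric.\<close>

lemma selfadjoint_shift_norm:
  assumes "(f, f') \<in> A" "c = \<i> \<or> c = - \<i>"
  shows "(norm (f' + c *\<^sub>C f))\<^sup>2 = (norm f')\<^sup>2 + (norm f)\<^sup>2"
proof -
  have "cinner f' f = cnj (cinner f' f)"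
    using selfadjointD[OF assms(1) assms(1)] cinner_commute by metis
  then have "Im (cinner f' f) = 0"
    by (simp add: complex_eq_iff)
  then show ?thesis
    using assms(2) by (auto simp: norm_add_scaleC_square)
qed

lemma selfadjoint_closed: "closed A"
proof (rule closed_sequential_limits[THEN iffD2], intro allI impI)
  fix x l assume *: "(\<forall>n. x n \<in> A) \<and> x \<longlonglongrightarrow> l"
  show "l \<in> A"
  proof (cases l)
    case (Pair g h)
    have 1: "(\<lambda>n. fst (x n)) \<longlonglongrightarrow> g" "(\<lambda>n. snd (x n)) \<longlonglongrightarrow> h"
      using * Pair tendsto_fst tendsto_snd by fastforce+
    have "cinner f' g = cinner f h" if "(f, f') \<in> A" for f f'
    proof (rule LIMSEQ_unique)
      show "(\<lambda>n. cinner f' (fst (x n))) \<longlonglongrightarrow> cinner f' g"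
        by (rule tendsto_cinner_right[OF 1(1)])
      have "cinner f' (fst (x n)) = cinner f (snd (x n))" for n
        using selfadjointD[OF that, of "fst (x n)" "snd (x n)"] * by simp
      then show "(\<lambda>n. cinner f' (fst (x n))) \<longlonglongrightarrow> cinner f h"
        using tendsto_cinner_right[OF 1(2)] by simp
    qed
    then show ?thesis
      unfolding Pair by (rule selfadjointI)
  qed
qed

text \<open>The range of \<open>A - \<i>\<close> is complete since \<open>A - \<i>\<close> does not decrease the graph norm, and its
  orthogonal complement consists of eigenvectors of \<open>A\<close> with eigenvalue \<open>-\<i>\<close>.\<close>

lemma selfadjoint_minus_ii_surj: "\<exists>f. (f, x + \<i> *\<^sub>C f) \<in> A"
proof -
  define T where "T p = snd p + (- \<i>) *\<^sub>C fst p" for p :: "'a \<times> 'a"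
  have lin: "T (p + q) = T p + T q" "T (c *\<^sub>C p) = c *\<^sub>C T p" "T (p - q) = T p - T q" for p q c
    by (simp_all add: T_def scaleC_prod_def scaleC_add_right scaleC_scaleC mult.commute
        complex_vector.scale_right_diff_distrib)
  have normT: "norm (T p) = norm p" if "p \<in> A" for p
  proof (rule power2_eq_imp_eq)
    show "(norm (T p))\<^sup>2 = (norm p)\<^sup>2"
      using selfadjoint_shift_norm[of "fst p" "snd p" "- \<i>"] that
      by (simp add: T_def norm_prod_def)
  qed simp_all
  have subA: "csubspace A"
    using selfadjoint_linear by (simp add: linear_operator_def)
  have "csubspace (T ` A)"
  proof (rule complex_vector.subspaceI)
    show "0 \<in> T ` A"
      using complex_vector.subspace_0[OF subA] by (force simp: T_def)
  next
    fix x y assume "x \<in> T ` A" "y \<in> T ` A"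
    then show "x + y \<in> T ` A"
      using complex_vector.subspace_add[OF subA] by (metis (no_types, lifting) imageE imageI lin(1))
  next
    fix c x assume "x \<in> T ` A"
    then show "c *\<^sub>C x \<in> T ` A"
      using complex_vector.subspace_scale[OF subA] by (metis (no_types, lifting) imageE imageI lin(2))
  qed
  moreover have "closed (T ` A)"
  proof (rule closed_sequential_limits[THEN iffD2], intro allI impI)
    fix y l assume *: "(\<forall>n. y n \<in> T ` A) \<and> y \<longlonglongrightarrow> l"
    then have "\<forall>n. \<exists>p. p \<in> A \<and> y n = T p"
      by blast
    then obtain p where p: "\<And>n. p n \<in> A" "\<And>n. y n = T (p n)"
      using choice[of "\<lambda>n p. p \<in> A \<and> y n = T p"] by blast
    have "dist (p m) (p n) = dist (y m) (y n)" for m n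
    proof -
      have "p m - p n \<in> A"
        using p subA complex_vector.subspace_diff by blast
      then show ?thesis
        using normT[of "p m - p n"] by (simp add: dist_norm p lin)
    qed
    moreover have "Cauchy y"
      using * LIMSEQ_imp_Cauchy by blast
    ultimately have "Cauchy p"
      by (simp add: Cauchy_def)
    then obtain q where q: "p \<longlonglongrightarrow> q"
      using Cauchy_convergent_iff convergent_def by blast
    then have "q \<in> A"
      using closed_sequentially[OF selfadjoint_closed] p(1) by blast
    moreover have "(\<lambda>n. T (p n)) \<longlonglongrightarrow> T q"
      unfolding T_def by (intro tendsto_add tendsto_snd tendsto_scaleC tendsto_fst q)
    then have "T q = l"
      using * LIMSEQ_unique[of y] by (simp flip: p(2))
    ultimately show "l \<in> T ` A" by blast
  qed
  moreover have "orthogonal_complement (T ` A) \<subseteq> {0}"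
  proof
    fix g assume g: "g \<in> orthogonal_complement (T ` A)"
    have "(g, (- \<i>) *\<^sub>C g) \<in> A"
    proof (rule selfadjointI)
      fix f f' assume "(f, f') \<in> A"
      then have "cinner g (f' + (- \<i>) *\<^sub>C f) = 0"
        using g by (force simp: orthogonal_complement_def T_def)
      then have "cinner (f' + (- \<i>) *\<^sub>C f) g = 0"
        by (metis cinner_commute complex_cnj_zero)
      then show "cinner f' g = cinner f ((- \<i>) *\<^sub>C g)"
        by (simp add: cinner_linear)
    qed
    then have "g = 0"
      by (rule selfadjoint_eigenvector_zero) simp
    then show "g \<in> {0}" by simp
  qed
  ultimately have "T ` A = UNIV"
    by (rule closed_csubspace_eq_UNIV)
  then have "x \<in> T ` A" by simp
  then obtain f f' where "(f, f') \<in> A" "x = f' + (- \<i>) *\<^sub>C f"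
    by (auto simp: T_def)
  then have "(f, x + \<i> *\<^sub>C f) \<in> A"
    by (simp add: complex_vector.scale_minus_left)
  then show ?thesis ..
qed

end

section \<open>Resolvents of isometries\<close>

locale linear_isometry =
  fixes U :: "'a::chilbert_space \<Rightarrow> 'a"
  assumes U_add: "U (x + y) = U x + U y"
    and U_scaleC: "U (c *\<^sub>C x) = c *\<^sub>C U x"
    and norm_U: "norm (U x) = norm x"
begin

lemma bounded_linear_U: "bounded_linear U"
  by (rule bounded_linear_intro[of _ 1]) (simp_all add: U_add U_scaleC scaleR_scaleC norm_U)

lemma U_diff: "U (x - y) = U x - U y"
  using bounded_linear_U by (rule bounded_linear.linear[THEN linear_diff])

lemma cinner_U: "cinner (U x) (U y) = cinner x y"
proof -
  have Re: "Re (cinner (U x) (U y)) = Re (cinner x y)" for x y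
  proof -
    have "(norm (U x + 1 *\<^sub>C U y))\<^sup>2 = (norm (x + 1 *\<^sub>C y))\<^sup>2"
      by (simp add: U_add[symmetric] norm_U)
    then show ?thesis
      unfolding norm_add_scaleC_square by (simp add: norm_U)
  qed
  \<comment> \<open>Rotating the first argument by -i exposes the imaginary part, so the polarised
    real identity suffices.\<close>
  have "Re (cinner (U (- \<i> *\<^sub>C x)) (U y)) = Re (cinner (- \<i> *\<^sub>C x) y)"
    by (rule Re)
  then have "Im (cinner (U x) (U y)) = Im (cinner x y)"
    by (simp only: U_scaleC cinner_scaleC_left) simp
  with Re show ?thesis
    by (simp add: complex_eq_iff)
qed

lemma norm_U_power: "norm ((U ^^ n) x) = norm x"
  by (induction n) (simp_all add: norm_U)

text \<open>The Gram matrix of an orbit is Toeplitz. This is why the Fejer sums below have the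
  numbers (U^n x, x) as Fourier coefficients.\<close>

lemma cinner_U_power: "cinner ((U ^^ (n + l)) x) ((U ^^ l) x) = cinner ((U ^^ n) x) x"
  by (induction l) (simp_all add: cinner_U)

text \<open>The vector (1 - w U)^{-1} x, written as the power series whose inner products generate
  the moments.\<close>

definition neumann_series :: "complex \<Rightarrow> 'a \<Rightarrow> 'a" where
  "neumann_series w x = (\<Sum>n. w ^ n *\<^sub>C (U ^^ n) x)"

lemma summable_neumann: "cmod w < 1 \<Longrightarrow> summable (\<lambda>n. w ^ n *\<^sub>C (U ^^ n) x)"
  by (rule summable_norm_cancel)
    (simp add: norm_scaleC norm_U_power norm_power summable_mult2 summable_geometric)

lemma neumann_series_eq:
  assumes "cmod w < 1"
  shows "neumann_series w x - w *\<^sub>C U (neumann_series w x) = x"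
proof -
  note s = summable_neumann[OF assms, of x]
  have "w *\<^sub>C U (neumann_series w x) = (\<Sum>n. w *\<^sub>C U (w ^ n *\<^sub>C (U ^^ n) x))"
    unfolding neumann_series_def
    using bounded_linear.suminf[OF bounded_linear_compose[OF bounded_linear_scaleC bounded_linear_U] s]
    by simp
  also have "\<dots> = (\<Sum>n. w ^ Suc n *\<^sub>C (U ^^ Suc n) x)"
    by (simp add: U_scaleC scaleC_scaleC)
  also have "\<dots> = neumann_series w x - x"
    unfolding neumann_series_def using suminf_split_head[OF s] by simp
  finally show ?thesis by simp
qed

lemma neumann_series_unique:
  assumes "cmod w < 1" "y - w *\<^sub>C U y = x"
  shows "y = neumann_series w x"
proof -
  define d where "d = y - neumann_series w x"
  have "d = w *\<^sub>C U d"
  proof -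
    have "d - w *\<^sub>C U d = (y - w *\<^sub>C U y) - (neumann_series w x - w *\<^sub>C U (neumann_series w x))"
      by (simp add: d_def U_diff complex_vector.scale_right_diff_distrib algebra_simps)
    also have "\<dots> = 0"
      unfolding assms(2) neumann_series_eq[OF assms(1)] by simp
    finally show ?thesis by simp
  qed
  then have "norm d = cmod w * norm d"
    by (metis norm_scaleC norm_U)
  then have "d = 0"
    using assms(1) by auto
  then show ?thesis
    by (simp add: d_def)
qed

lemma norm_neumann_series_le:
  assumes "cmod w < 1"
  shows "(1 - cmod w) * norm (neumann_series w x) \<le> norm x"
proof -
  let ?k = "neumann_series w x"
  have "norm ?k - norm (w *\<^sub>C U ?k) \<le> norm (?k - w *\<^sub>C U ?k)"
    by (rule norm_triangle_ineq2)
  then show ?thesis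
    by (simp add: neumann_series_eq[OF assms] norm_scaleC norm_U algebra_simps)
qed

lemma cinner_neumann_series_sums:
  assumes "cmod w < 1"
  shows "(\<lambda>n. w ^ n * cinner ((U ^^ n) x) y) sums cinner (neumann_series w x) y"
  using bounded_linear.sums[OF bounded_linear_cinner_left summable_sums[OF summable_neumann[OF assms]], of x y]
  by (simp add: neumann_series_def cinner_scaleC_left)

text \<open>Expand the norm of k - w U k = x and compare with \<open>cinner k x\<close>. This is the
  operator form of the Poisson kernel identity; it yields both the positivity of Im V and the
  integral of the Abel kernel.\<close>

lemma norm_neumann_series:
  assumes "cmod w < 1"
  shows "(1 - (cmod w)\<^sup>2) * (norm (neumann_series w x))\<^sup>2
    = 2 * Re (cinner (neumann_series w x) x) - (norm x)\<^sup>2"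
proof -
  define k where "k = neumann_series w x"
  have k: "k + (- w) *\<^sub>C U k = x"
    using neumann_series_eq[OF assms, of x]
    by (simp add: k_def complex_vector.scale_minus_left)
  have "(norm x)\<^sup>2 = (norm (k + (- w) *\<^sub>C U k))\<^sup>2"
    by (simp only: k)
  then have "(norm x)\<^sup>2 = (norm k)\<^sup>2 + (cmod w * norm k)\<^sup>2 + 2 * Re (cnj (- w) * cinner k (U k))"
    unfolding norm_add_scaleC_square by (simp add: norm_U)
  moreover have "cinner k x = complex_of_real ((norm k)\<^sup>2) + cnj (- w) * cinner k (U k)"
    unfolding cinner_self[symmetric] by (subst k[symmetric]) (simp only: cinner_add_right cinner_scaleC_right)
  then have "Re (cinner k x) = (norm k)\<^sup>2 + Re (cnj (- w) * cinner k (U k))"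
    by simp
  ultimately show ?thesis
    by (simp add: k_def[symmetric] power_mult_distrib algebra_simps)
qed

text \<open>The Abel means of \<open>U x - x\<close> telescope.\<close>

lemma norm_abel_mean_le:
  assumes "0 \<le> r" "r < 1"
  shows "(1 - r) * norm (neumann_series (complex_of_real r) g)
    \<le> 2 * (1 - r) * norm x + norm (g - (U x - x))"
proof -
  define k where "k = neumann_series (complex_of_real r) g"
  define e where "e = g - (U x - x)"
  have r: "cmod (complex_of_real r) < 1"
    using assms by simp
  have "k - complex_of_real r *\<^sub>C U k = g"
    unfolding k_def by (rule neumann_series_eq[OF r])
  \<comment> \<open>Substituting g = U x - x + e, the shift of k by x leaves a right-hand side of
    size at most (1 - r) * norm x + norm e.\<close>
  then have "k + x - complex_of_real r *\<^sub>C U (k + x) = (1 - r) *\<^sub>R U x + e"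
    by (simp add: U_add scaleC_add_right e_def algebra_simps flip: scaleR_scaleC)
  then have "k + x = neumann_series (complex_of_real r) ((1 - r) *\<^sub>R U x + e)"
    by (rule neumann_series_unique[OF r])
  then have "(1 - r) * norm (k + x) \<le> norm ((1 - r) *\<^sub>R U x + e)"
    using norm_neumann_series_le[OF r] assms by simp
  also have "\<dots> \<le> (1 - r) * norm x + norm e"
    using norm_triangle_ineq[of "(1 - r) *\<^sub>R U x" e] assms by (simp add: norm_U)
  finally have "(1 - r) * norm (k + x) \<le> (1 - r) * norm x + norm e" .
  moreover have "(1 - r) * norm k \<le> (1 - r) * (norm (k + x) + norm x)"
    using norm_triangle_ineq4[of "k + x" x] assms by (intro mult_left_mono) auto
  ultimately show ?thesis
    by (simp add: k_def e_def algebra_simps)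
qed

text \<open>Inserting g = y - r U y and using that U is isometric gives (U k - k, y) + (1 - r) (k,
  y). The second term vanishes as r tends to 1 because y stays bounded.\<close>

lemma cmod_cinner_U_le:
  assumes B: "\<And>r. 0 \<le> r \<Longrightarrow> r < 1 \<Longrightarrow> norm (neumann_series (complex_of_real r) g) \<le> B"
  shows "cmod (cinner (U k) g) \<le> B * norm (U k - k)"
proof -
  have bound: "cmod (cinner (U k) g) \<le> B * norm (U k - k) + (1 - r) * (norm k * B)"
    if r: "0 \<le> r" "r < 1" for r :: real
  proof -
    define y where "y = neumann_series (complex_of_real r) g"
    have "cinner (U k) g = cinner (U k) (y - complex_of_real r *\<^sub>C U y)"
      unfolding y_def using r by (simp add: neumann_series_eq)
    also have "\<dots> = cinner (U k) y - r * cinner k y"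
      by (simp add: cinner_linear cinner_U)
    also have "\<dots> = cinner (U k - k) y + (1 - r) * cinner k y"
      by (simp add: cinner_linear algebra_simps)
    finally have "cmod (cinner (U k) g) \<le> cmod (cinner (U k - k) y) + cmod ((1 - r) * cinner k y)"
      by (simp add: norm_triangle_ineq)
    also have "\<dots> = cmod (cinner (U k - k) y) + (1 - r) * cmod (cinner k y)"
    proof -
      have "cmod (1 - complex_of_real r) = 1 - r"
        using r norm_of_real[of "1 - r", where 'a = complex] by simp
      then show ?thesis by (simp add: norm_mult)
    qed
    also have "\<dots> \<le> norm (U k - k) * norm y + (1 - r) * (norm k * norm y)"
      using r by (intro add_mono mult_left_mono cmod_cinner_le) auto
    also have "\<dots> \<le> norm (U k - k) * B + (1 - r) * (norm k * B)"
      using r B by (intro add_mono mult_left_mono) (auto simp: y_def)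
    finally show ?thesis by (simp add: mult.commute)
  qed
  have "((\<lambda>r. B * norm (U k - k) + (1 - r) * (norm k * B)) \<longlongrightarrow>
      B * norm (U k - k) + (1 - 1) * (norm k * B)) (at_left (1::real))"
    by (intro tendsto_intros)
  moreover have "eventually (\<lambda>r::real. cmod (cinner (U k) g)
      \<le> B * norm (U k - k) + (1 - r) * (norm k * B)) (at_left 1)"
    using eventually_at_left_real[of 0 "1::real"] by (rule eventually_mono) (auto intro: bound)
  ultimately have "cmod (cinner (U k) g) \<le> B * norm (U k - k) + (1 - 1) * (norm k * B)"
    by (rule tendsto_lowerbound) simp
  then show ?thesis by simp
qed

end

section \<open>The spectral measure of an isometry\<close>

lemma has_bochner_integral_exp_int:
  "has_bochner_integral lborel (\<lambda>t. indicator {0..2 * pi} t *\<^sub>R iexp (real_of_int m * t))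
     (if m = 0 then complex_of_real (2 * pi) else 0)"
proof (cases "m = 0")
  case True
  have "has_bochner_integral lborel (\<lambda>t. indicator {0..2 * pi} t *\<^sub>R (1::complex))
    (complex_of_real (2 * pi) - complex_of_real 0)"
    by (rule has_bochner_integral_FTC_Icc)
      (auto intro!: derivative_eq_intros simp: has_vector_derivative_def scaleR_conv_of_real)
  with True show ?thesis by simp
next
  case False
  define F where "F t = iexp (real_of_int m * t) / (\<i> * of_int m)" for t
  have "((\<lambda>z. exp (\<i> * (of_int m * z)) / (\<i> * of_int m)) has_field_derivative
      exp (\<i> * (of_int m * z))) (at z)" for z
    using False by (auto intro!: derivative_eq_intros simp: field_simps)
  then have "(F has_vector_derivative iexp (real_of_int m * t)) (at t within {0..2 * pi})" for t
    unfolding F_def using has_vector_derivative_real_field by fastforce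
  then have "has_bochner_integral lborel (\<lambda>t. indicator {0..2 * pi} t *\<^sub>R iexp (real_of_int m * t))
    (F (2 * pi) - F 0)"
    by (intro has_bochner_integral_FTC_Icc) (auto intro!: continuous_intros)
  moreover have "iexp (real_of_int m * (2 * pi)) = 1"
    using exp_integer_2pi[of "of_int m"] by (simp add: mult_ac)
  ultimately show ?thesis
    using False by (simp add: F_def)
qed

context linear_isometry
begin

text \<open>The Cesaro mean of the formal Fourier series with the moments as coefficients, written
  as a squared norm so that positivity is evident. The indicator confines all measures to one
  period, which gives tightness.\<close>

definition fejer_density :: "'a \<Rightarrow> nat \<Rightarrow> real \<Rightarrow> real" where
  "fejer_density g N t = indicator {0..2 * pi} t *
     ((norm (\<Sum>k<N. iexp (- real k * t) *\<^sub>C (U ^^ k) g))\<^sup>2 / (2 * pi * real N))"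

lemma fejer_density_nonneg: "0 \<le> fejer_density g N t"
  by (simp add: fejer_density_def indicator_def)

lemma norm_trig_sum:
  "complex_of_real ((norm (\<Sum>k<N. iexp (- real k * t) *\<^sub>C (U ^^ k) g))\<^sup>2) =
   (\<Sum>k<N. \<Sum>l<N. cinner ((U ^^ k) g) ((U ^^ l) g) * iexp ((real l - real k) * t))"
proof -
  have "cnj (iexp (- real l * t)) = iexp (real l * t)" for l
    by (simp add: exp_cnj)
  then have e: "iexp (- real k * t) * cnj (iexp (- real l * t)) = iexp ((real l - real k) * t)" for k l
    by (simp add: exp_add[symmetric] algebra_simps)
  have "complex_of_real ((norm (\<Sum>k<N. iexp (- real k * t) *\<^sub>C (U ^^ k) g))\<^sup>2) =
      (\<Sum>k<N. cinner (iexp (- real k * t) *\<^sub>C (U ^^ k) g) (\<Sum>l<N. iexp (- real l * t) *\<^sub>C (U ^^ l) g))"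
    unfolding cinner_self[symmetric] cinner_sum_left ..
  also have "\<dots> = (\<Sum>k<N. \<Sum>l<N. cinner ((U ^^ k) g) ((U ^^ l) g) *
      (iexp (- real k * t) * cnj (iexp (- real l * t))))"
    unfolding cinner_sum_right cinner_scaleC_left cinner_scaleC_right
    by (intro sum.cong refl) (simp only: mult_ac)
  finally show ?thesis
    unfolding e .
qed

lemma has_bochner_integral_fejer:
  assumes "0 < N"
  shows "has_bochner_integral lborel (\<lambda>t. fejer_density g N t *\<^sub>R iexp (real n * t))
    (complex_of_real (real (N - n) / real N) * cinner ((U ^^ n) g) g)"
proof -
  define c where "c k l = cinner ((U ^^ k) g) ((U ^^ l) g) / (2 * pi * N)" for k l
  define e where "e m t = indicator {0..2 * pi} t *\<^sub>R iexp (real_of_int m * t)" for m t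
  have "fejer_density g N t *\<^sub>R iexp (real n * t)
      = (\<Sum>k<N. \<Sum>l<N. c k l * e (int n + int l - int k) t)" for t
  proof -
    have "iexp (real n * t) * iexp ((real l - real k) * t)
      = iexp (real_of_int (int n + int l - int k) * t)" for k l
      by (simp add: exp_add[symmetric] algebra_simps)
    note exp_eq = this
    have "fejer_density g N t *\<^sub>R iexp (real n * t) = (indicator {0..2 * pi} t / (2 * pi * N)) *
        (complex_of_real ((norm (\<Sum>k<N. iexp (- real k * t) *\<^sub>C (U ^^ k) g))\<^sup>2) * iexp (real n * t))"
      unfolding fejer_density_def scaleR_conv_of_real of_real_mult of_real_divide by simp
    also have "\<dots> = (indicator {0..2 * pi} t / (2 * pi * N)) *
        (\<Sum>k<N. \<Sum>l<N. cinner ((U ^^ k) g) ((U ^^ l) g) * iexp (real_of_int (int n + int l - int k) * t))"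
      unfolding norm_trig_sum sum_distrib_right mult.assoc exp_eq[symmetric]
      by (simp add: mult.commute)
    also have "\<dots> = (\<Sum>k<N. \<Sum>l<N. c k l * e (int n + int l - int k) t)"
      unfolding sum_distrib_left c_def e_def scaleR_conv_of_real
      by (intro sum.cong refl) (simp add: indicator_def)
    finally show ?thesis .
  qed
  moreover have "has_bochner_integral lborel
      (\<lambda>t. \<Sum>k<N. \<Sum>l<N. c k l * e (int n + int l - int k) t)
      (\<Sum>k<N. \<Sum>l<N. c k l * (if int n + int l - int k = 0 then complex_of_real (2 * pi) else 0))"
    unfolding e_def
    by (intro has_bochner_integral_sum has_bochner_integral_mult_right has_bochner_integral_exp_int)
  moreover have "(\<Sum>k<N. \<Sum>l<N. c k l * (if int n + int l - int k = 0 then complex_of_real (2 * pi) else 0))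
      = complex_of_real (real (N - n) / real N) * cinner ((U ^^ n) g) g"
  proof -
    \<comment> \<open>Orthogonality leaves only k = n + l, where the Toeplitz property makes all
      terms equal. There are N - n of them; truncated subtraction correctly gives 0 for n \<ge>
      N.\<close>
    have "(\<Sum>k<N. \<Sum>l<N. c k l * (if int n + int l - int k = 0 then complex_of_real (2 * pi) else 0))
      = (\<Sum>l<N. \<Sum>k<N. if k = n + l then c (n + l) l * complex_of_real (2 * pi) else 0)"
      by (subst sum.swap) (intro sum.cong refl, auto)
    also have "\<dots> = (\<Sum>l<N. if n + l < N then c (n + l) l * complex_of_real (2 * pi) else 0)"
      by (simp add: sum.delta)
    also have "\<dots> = (\<Sum>l<N. if n + l < N then cinner ((U ^^ n) g) g / N else 0)"
      by (intro sum.cong refl) (simp add: c_def cinner_U_power)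
    also have "\<dots> = (\<Sum>l\<in>{..<N - n}. cinner ((U ^^ n) g) g / N)"
      by (intro sum.mono_neutral_cong_right) auto
    also have "\<dots> = complex_of_real (real (N - n) / real N) * cinner ((U ^^ n) g) g"
      by simp
    finally show ?thesis .
  qed
  ultimately show ?thesis by simp
qed

lemma fejer_density_measurable [measurable]: "fejer_density g N \<in> borel_measurable borel"
proof -
  \<comment> \<open>Cosine and sine turn the varying complex scalar into real scalars acting on
    fixed vectors, so that the continuity rules for \<open>scaleR\<close> apply.\<close>
  have "iexp (- real k * t) = complex_of_real (cos (real k * t))
      + complex_of_real (sin (real k * t)) * (- \<i>)" for k t
    by (simp add: complex_eq_iff Re_exp Im_exp)
  then have "(\<lambda>t. iexp (- real k * t) *\<^sub>C (U ^^ k) g) = (\<lambda>t. cos (real k * t) *\<^sub>R (U ^^ k) g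
      + sin (real k * t) *\<^sub>R ((- \<i>) *\<^sub>C (U ^^ k) g))" for k
    by (simp only: scaleR_scaleC scaleC_scaleC scaleC_add_left)
  note eq = this
  have "continuous_on UNIV (\<lambda>t. iexp (- real k * t) *\<^sub>C (U ^^ k) g)" for k
    unfolding eq by (intro continuous_intros)
  then have "(\<lambda>t. (norm (\<Sum>k<N. iexp (- real k * t) *\<^sub>C (U ^^ k) g))\<^sup>2) \<in> borel_measurable borel"
    by (intro borel_measurable_continuous_onI continuous_intros)
  then show ?thesis
    unfolding fejer_density_def by measurable
qed

text \<open>Existence in the Herglotz theorem for the positive definite sequence (U^n g, g). Weak
  convergence passes to characteristic functions, and the Fejer weights 1 - n/N tend to 1.\<close>

lemma trigonometric_moments:
  assumes "norm g = 1"
  shows "\<exists>M. real_distribution M \<and> (\<forall>n. char M (real n) = cinner ((U ^^ n) g) g)"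
proof -
  \<comment> \<open>The index \<open>Suc N\<close> avoids the empty sum and the division by
    0.\<close>
  define \<mu> where "\<mu> N = density lborel (fejer_density g (Suc N))" for N
  have fourier: "(\<integral>t. iexp (real n * t) \<partial>\<mu> N)
      = complex_of_real (real (Suc N - n) / real (Suc N)) * cinner ((U ^^ n) g) g" for n N
    unfolding \<mu>_def using has_bochner_integral_fejer[of "Suc N" g n]
    by (subst integral_density) (auto simp: fejer_density_nonneg has_bochner_integral_iff)
  then have char_\<mu>: "char (\<mu> N) (real n)
      = complex_of_real (real (Suc N - n) / real (Suc N)) * cinner ((U ^^ n) g) g" for n N
    by (simp add: char_def)
  have total: "(\<integral>\<^sup>+t. fejer_density g (Suc N) t \<partial>lborel) = 1" for N
  proof -
    have "has_bochner_integral lborel (\<lambda>t. complex_of_real (fejer_density g (Suc N) t)) (complex_of_real 1)"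
      using has_bochner_integral_fejer[of "Suc N" g 0] assms
      by (simp add: scaleR_conv_of_real cinner_self)
    then have "integrable lborel (fejer_density g (Suc N))" "integral\<^sup>L lborel (fejer_density g (Suc N)) = 1"
      by (simp_all add: has_bochner_integral_iff complex_of_real_integrable_eq)
    then show ?thesis
      by (subst nn_integral_eq_integral) (auto simp: fejer_density_nonneg)
  qed
  have dist: "real_distribution (\<mu> N)" for N
  proof (intro real_distribution.intro prob_spaceI real_distribution_axioms.intro)
    show "emeasure (\<mu> N) (space (\<mu> N)) = 1"
      using total by (simp add: \<mu>_def emeasure_density)
  qed (simp add: \<mu>_def)
  interpret \<mu>: real_distribution "\<mu> N" for N by (rule dist)
  \<comment> \<open>Tightness is phrased with left-open intervals; starting at -1 keeps the endpoint
    0 of the period inside.\<close>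
  have conc: "measure (\<mu> N) {-1<..2 * pi} = 1" for N
  proof -
    have "emeasure (\<mu> N) {-1<..2 * pi}
        = (\<integral>\<^sup>+t. ennreal (fejer_density g (Suc N) t) * indicator {-1<..2 * pi} t \<partial>lborel)"
      unfolding \<mu>_def by (subst emeasure_density) simp_all
    also have "\<dots> = (\<integral>\<^sup>+t. fejer_density g (Suc N) t \<partial>lborel)"
      by (intro nn_integral_cong) (auto simp: fejer_density_def indicator_def)
    finally have "emeasure (\<mu> N) {-1<..2 * pi} = (\<integral>\<^sup>+t. fejer_density g (Suc N) t \<partial>lborel)" .
    then show ?thesis
      by (simp add: total measure_def)
  qed
  have "tight \<mu>"
    unfolding tight_def
  proof (intro conjI allI impI)
    fix \<epsilon> :: real assume "0 < \<epsilon>"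
    then show "\<exists>a b. a < b \<and> (\<forall>N. measure (\<mu> N) {a<..b} > 1 - \<epsilon>)"
    proof (intro exI conjI allI)
      show "-1 < 2 * pi"
        using pi_gt_zero by linarith
      show "measure (\<mu> N) {-1<..2 * pi} > 1 - \<epsilon>" for N
        using conc \<open>0 < \<epsilon>\<close> by simp
    qed
  qed (rule dist)
  then obtain r M where r: "strict_mono (r :: nat \<Rightarrow> nat)" and M: "real_distribution M"
    and conv: "weak_conv_m (\<mu> \<circ> id \<circ> r) M"
    using tight_imp_convergent_subsubsequence[of \<mu> id] by (auto simp: strict_mono_def)
  have "char M (real n) = cinner ((U ^^ n) g) g" for n
  proof (rule LIMSEQ_unique)
    show "(\<lambda>N. char ((\<mu> \<circ> id \<circ> r) N) (real n)) \<longlonglongrightarrow> char M (real n)"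
      by (rule levy_continuity1[OF _ M conv]) (simp add: dist)
    have "(\<lambda>N. real (Suc N - n) / real (Suc N)) \<longlonglongrightarrow> 1"
    proof (rule Lim_transform_eventually)
      show "(\<lambda>N. 1 - real n * inverse (real (Suc N))) \<longlonglongrightarrow> 1"
        using tendsto_diff[OF tendsto_const tendsto_mult[OF tendsto_const LIMSEQ_inverse_real_of_nat],
            of 1 "real n"] by simp
      show "eventually (\<lambda>N. 1 - real n * inverse (real (Suc N)) = real (Suc N - n) / real (Suc N)) sequentially"
        using eventually_ge_at_top[of n]
        by eventually_elim (simp add: of_nat_diff field_simps)
    qed
    then have "(\<lambda>N. real (Suc (r N) - n) / real (Suc (r N))) \<longlonglongrightarrow> 1"
      using LIMSEQ_subseq_LIMSEQ[OF _ r] unfolding comp_def by blast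
    then have "(\<lambda>N. complex_of_real (real (Suc (r N) - n) / real (Suc (r N))) * cinner ((U ^^ n) g) g)
        \<longlonglongrightarrow> complex_of_real 1 * cinner ((U ^^ n) g) g"
      by (intro tendsto_mult tendsto_of_real tendsto_const)
    then show "(\<lambda>N. char ((\<mu> \<circ> id \<circ> r) N) (real n)) \<longlonglongrightarrow> cinner ((U ^^ n) g) g"
      unfolding comp_def id_def char_\<mu> by simp
  qed
  with M show ?thesis by blast
qed

end

section \<open>The Donoghue class\<close>

text \<open>The Cayley transform \<open>t = \<i> (\<zeta> + 1) / (\<zeta> - 1)\<close> for \<open>\<zeta> = exp (\<i> s)\<close> is \<open>t = cot (s / 2)\<close>.\<close>

lemma iexp_half_angle:
  "iexp s = complex_of_real ((cos (s/2))\<^sup>2 - (sin (s/2))\<^sup>2) + 2 * \<i> * (sin (s/2) * cos (s/2))"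
proof -
  have "iexp s = (cis (s/2))\<^sup>2"
    by (simp add: cis_conv_exp exp_of_nat_mult[symmetric])
  then show ?thesis
    by (simp add: complex_eq_iff power2_eq_square)
qed

lemma norm_one_minus_iexp: "(cmod (1 - iexp s))\<^sup>2 = 4 * (sin (s/2))\<^sup>2"
proof -
  define c where "c = cos (s/2)" define d where "d = sin (s/2)"
  have "c\<^sup>2 = 1 - d\<^sup>2"
    by (simp add: c_def d_def cos_squared_eq)
  moreover have "(cmod (1 - iexp s))\<^sup>2 = (1 - (c\<^sup>2 - d\<^sup>2))\<^sup>2 + (2 * (d * c))\<^sup>2"
    unfolding iexp_half_angle cmod_power2 c_def[symmetric] d_def[symmetric] by simp
  ultimately show ?thesis
    by (simp add: power_mult_distrib d_def[symmetric])
      (simp add: power2_eq_square power4_eq_xxxx algebra_simps)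
qed

lemma iexp_eq_1_iff: "iexp s = 1 \<longleftrightarrow> sin (s/2) = 0"
  using norm_one_minus_iexp[of s] by auto

text \<open>Kept free of division so that it can serve as a polynomial hypothesis in the kernel
  computation below.\<close>

lemma cayley_cot:
  assumes "iexp s \<noteq> 1"
  shows "complex_of_real (cot (s/2)) * (iexp s - 1) = \<i> * (iexp s + 1)"
proof -
  define c where "c = complex_of_real (cos (s/2))"
  define d where "d = complex_of_real (sin (s/2))"
  have d: "d \<noteq> 0" "c\<^sup>2 + d\<^sup>2 = 1"
    using assms by (simp_all add: d_def c_def iexp_eq_1_iff flip: of_real_power of_real_add)
  have e: "iexp s = c\<^sup>2 - d\<^sup>2 + 2 * \<i> * (d * c)"
    unfolding iexp_half_angle c_def d_def by simp
  have "c * (c\<^sup>2 - d\<^sup>2 + 2 * \<i> * (d * c) - 1) = \<i> * (c\<^sup>2 - d\<^sup>2 + 2 * \<i> * (d * c) + 1) * d"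
    using d(2) i_squared by algebra
  then show ?thesis
    unfolding e using d(1) by (simp add: cot_def c_def[symmetric] d_def[symmetric] field_simps)
qed

lemma cayley_disc:
  assumes "Im z > 0"
  shows "cmod ((z - \<i>) / (z + \<i>)) < 1"
proof -
  have "(cmod (z - \<i>))\<^sup>2 < (cmod (z + \<i>))\<^sup>2"
    using assms unfolding cmod_power2 by (simp add: power2_eq_square algebra_simps)
  then have "cmod (z - \<i>) < cmod (z + \<i>)"
    by (rule power_less_imp_less_base) simp
  moreover have "z + \<i> \<noteq> 0"
    using assms by (auto simp: complex_eq_iff)
  ultimately show ?thesis
    by (simp add: norm_divide)
qed

text \<open>The left side is (1 + t z) / (t - z). Cayley transforms of both variables turn it into
  the Herglotz kernel i (1 + w \<zeta>) / (1 - w \<zeta>).\<close>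

lemma nevanlinna_kernel_cayley:
  fixes t :: real
  assumes z: "Im z > 0" and t: "complex_of_real t * (\<zeta> - 1) = \<i> * (\<zeta> + 1)"
    and norm: "cmod \<zeta> = 1" and w: "w = (z - \<i>) / (z + \<i>)"
  shows "(1 + t\<^sup>2) *\<^sub>R (1 / (complex_of_real t - z) - complex_of_real (t / (1 + t\<^sup>2)))
    = \<i> * (2 * (1 / (1 - w * \<zeta>)) - 1)"
proof -
  have zi: "z + \<i> \<noteq> 0"
    using z by (auto simp: complex_eq_iff)
  have tz: "complex_of_real t - z \<noteq> 0"
    using z by (auto simp: complex_eq_iff)
  have "cmod (w * \<zeta>) < 1"
    unfolding norm_mult norm w using cayley_disc[OF z] by simp
  then have w1: "1 - w * \<zeta> \<noteq> 0"
    by auto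
  have "complex_of_real (1 + t\<^sup>2) \<noteq> 0"
    unfolding of_real_eq_0_iff using zero_le_power2[of t] by linarith
  then have t1: "1 + complex_of_real t ^ 2 \<noteq> 0"
    by simp
  have "(1 + t\<^sup>2) *\<^sub>R (1 / (complex_of_real t - z) - complex_of_real (t / (1 + t\<^sup>2)))
      = (1 + complex_of_real t ^ 2) / (complex_of_real t - z) - complex_of_real t"
    using t1 by (simp add: scaleR_conv_of_real right_diff_distrib)
  also have "\<dots> = (1 + complex_of_real t * z) / (complex_of_real t - z)"
    using tz by (simp add: field_simps power2_eq_square)
  also have "\<dots> = \<i> * (1 + w * \<zeta>) / (1 - w * \<zeta>)"
  proof -
    have wz: "w * (z + \<i>) = z - \<i>"
      using zi by (simp add: w)
    \<comment> \<open>The extra factors clear the denominators of both Cayley transforms, leaving a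
      consequence of three polynomial relations. They cancel afterwards, as \<zeta> = 1 would give 0
      = 2 i in the hypothesis \<open>t\<close>.\<close>
    have "(z + \<i>) * (\<zeta> - 1) * ((1 + complex_of_real t * z) * (1 - w * \<zeta>)) =
      (z + \<i>) * (\<zeta> - 1) * (\<i> * (1 + w * \<zeta>) * (complex_of_real t - z))"
      using wz t i_squared by algebra
    moreover have "\<zeta> - 1 \<noteq> 0"
      using t by auto
    ultimately have "(1 + complex_of_real t * z) * (1 - w * \<zeta>) =
      \<i> * (1 + w * \<zeta>) * (complex_of_real t - z)"
      using zi by simp
    then show ?thesis
      using tz w1 by (simp add: divide_simps)
  qed
  also have "\<dots> = \<i> * (2 * (1 / (1 - w * \<zeta>)) - 1)"
    using w1 by (simp add: divide_simps)
  finally show ?thesis .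
qed

section \<open>Integrals against the moment measure\<close>

locale isometry_moments = linear_isometry U for U :: "'a::chilbert_space \<Rightarrow> 'a" +
  fixes g :: 'a and \<sigma> :: "real measure"
  assumes norm_g: "norm g = 1"
    and real_distribution_\<sigma>: "real_distribution \<sigma>"
    and char_\<sigma>: "char \<sigma> (real n) = cinner ((U ^^ n) g) g"
begin

sublocale real_distribution \<sigma>
  by (rule real_distribution_\<sigma>)

lemma one_minus_iexp_nonzero: "cmod w < 1 \<Longrightarrow> 1 - w * iexp s \<noteq> 0"
  by (metis mult.right_neutral norm_exp_i_times norm_mult norm_one order_less_irrefl right_minus_eq)

text \<open>Termwise integration of the geometric series, dominated by the powers of |w|; the two
  sides have the same moments as power series coefficients.\<close>

lemma generating_function:
  assumes w: "cmod w < 1"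
  shows "integrable \<sigma> (\<lambda>s. 1 / (1 - w * iexp s))"
    and "(\<integral>s. 1 / (1 - w * iexp s) \<partial>\<sigma>) = cinner (neumann_series w g) g"
proof -
  define f where "f n s = w ^ n * iexp (real n * s)" for n s
  have f_eq: "f n s = (w * iexp s) ^ n" for n s
    by (simp add: f_def power_mult_distrib exp_of_nat_mult[symmetric] mult_ac)
  have norm_f: "norm (f n s) = cmod w ^ n" for n s
    by (simp add: f_eq norm_power norm_mult)
  have int: "integrable \<sigma> (f n)" for n
  proof (rule integrable_const_bound)
    show "AE s in \<sigma>. norm (f n s) \<le> cmod w ^ n"
      by (simp add: norm_f)
    show "f n \<in> borel_measurable \<sigma>"
      unfolding f_def[abs_def] by measurable
  qed
  have sum: "AE s in \<sigma>. summable (\<lambda>n. norm (f n s))"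
    "summable (\<lambda>n. \<integral>s. norm (f n s) \<partial>\<sigma>)"
    using w by (auto simp: norm_f prob_space summable_geometric)
  have suminf: "(\<Sum>n. f n s) = 1 / (1 - w * iexp s)" for s
    unfolding f_eq by (rule suminf_geometric) (simp add: norm_mult w)
  show "integrable \<sigma> (\<lambda>s. 1 / (1 - w * iexp s))"
    using integrable_suminf[OF int sum] by (simp add: suminf)
  have "(\<lambda>n. integral\<^sup>L \<sigma> (f n)) sums (\<integral>s. 1 / (1 - w * iexp s) \<partial>\<sigma>)"
    using sums_integral[OF int sum] by (simp add: suminf)
  moreover have "integral\<^sup>L \<sigma> (f n) = w ^ n * cinner ((U ^^ n) g) g" for n
    unfolding f_def char_\<sigma>[symmetric] char_def by simp
  ultimately show "(\<integral>s. 1 / (1 - w * iexp s) \<partial>\<sigma>) = cinner (neumann_series w g) g"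
    using cinner_neumann_series_sums[OF w, of g g] sums_unique2 by simp
qed

text \<open>For |u| = r one has 1 / |1 - u|^2 = (2 Re (1 / (1 - u)) - 1) / (1 - r^2). This is the
  scalar case of \<open>norm_neumann_series\<close>, so the generating function settles both
  sides.\<close>

lemma integral_abel_kernel:
  assumes r: "0 \<le> r" "r < 1"
  shows "integrable \<sigma> (\<lambda>s. 1 / (cmod (1 - complex_of_real r * iexp s))\<^sup>2)"
    and "(\<integral>s. 1 / (cmod (1 - complex_of_real r * iexp s))\<^sup>2 \<partial>\<sigma>)
      = (norm (neumann_series (complex_of_real r) g))\<^sup>2"
proof -
  define w where "w = complex_of_real r"
  have w: "cmod w < 1" "cmod w = r"
    using r by (simp_all add: w_def)
  have r2: "1 - r\<^sup>2 > 0"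
    using r by (simp add: power_less_one_iff)
  have eq: "1 / (cmod (1 - w * iexp s))\<^sup>2 = (2 * Re (1 / (1 - w * iexp s)) - 1) / (1 - r\<^sup>2)" for s
  proof -
    define u where "u = w * iexp s"
    have "cmod u = r"
      by (simp add: u_def norm_mult w(2))
    then have u: "(Re u)\<^sup>2 + (Im u)\<^sup>2 = r\<^sup>2" "1 - u \<noteq> 0"
      using cmod_power2[of u] one_minus_iexp_nonzero[OF w(1), of s] by (simp_all add: u_def)
    have "Re (1 / (1 - u)) = (1 - Re u) / (cmod (1 - u))\<^sup>2"
      by (simp add: Re_divide cmod_power2)
    moreover have "(cmod (1 - u))\<^sup>2 = 1 - 2 * Re u + r\<^sup>2"
      unfolding cmod_power2 u(1)[symmetric] by (simp add: power2_eq_square algebra_simps)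
    moreover have "(cmod (1 - u))\<^sup>2 \<noteq> 0"
      using u(2) by simp
    ultimately show ?thesis
      unfolding u_def[symmetric] using r2 by (simp add: divide_simps) (simp add: algebra_simps)
  qed
  note gf = generating_function[OF w(1)]
  show "integrable \<sigma> (\<lambda>s. 1 / (cmod (1 - complex_of_real r * iexp s))\<^sup>2)"
    unfolding w_def[symmetric] eq using gf(1)
    by (intro integrable_divide Bochner_Integration.integrable_diff integrable_mult_right integrable_Re) auto
  have "(\<integral>s. 1 / (cmod (1 - w * iexp s))\<^sup>2 \<partial>\<sigma>)
      = (2 * Re (\<integral>s. 1 / (1 - w * iexp s) \<partial>\<sigma>) - 1) / (1 - r\<^sup>2)"
    unfolding eq using gf(1) integrable_Re[OF gf(1)] by (simp add: integral_Re prob_space[simplified])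
  also have "\<dots> = (norm (neumann_series w g))\<^sup>2"
    using norm_neumann_series[OF w(1), of g] r2 by (simp add: gf(2) norm_g w(2) field_simps)
  finally show "(\<integral>s. 1 / (cmod (1 - complex_of_real r * iexp s))\<^sup>2 \<partial>\<sigma>)
      = (norm (neumann_series (complex_of_real r) g))\<^sup>2"
    by (simp add: w_def)
qed

text \<open>The kernel (1 - r)^2 / |1 - r exp(is)|^2 equals 1 on the exceptional set, so its
  integral, the squared norm of an Abel mean of g, bounds the mass there. On the closure of the
  range of U - 1 these means tend to 0, as in the mean ergodic theorem.\<close>

lemma AE_iexp_neq_1:
  assumes "g \<in> closure (range (\<lambda>x. U x - x))"
  shows "AE s in \<sigma>. iexp s \<noteq> 1"
proof -
  define E where "E = {s. iexp s = 1}"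
  have E: "E \<in> sets \<sigma>"
    unfolding E_def by simp
  have bound: "prob E \<le> e\<^sup>2" if e: "e > 0" for e
  proof -
    obtain x where x: "dist (U x - x) g < e"
      using assms e unfolding closure_approachable by blast
    define b where "b r = 2 * (1 - r) * norm x + norm (g - (U x - x))" for r :: real
    have le: "prob E \<le> (b r)\<^sup>2" if r: "0 < r" "r < 1" for r
    proof -
      have "prob E = (\<integral>s. indicator E s \<partial>\<sigma>)"
        using E by simp
      also have "\<dots> \<le> (\<integral>s. (1 - r)\<^sup>2 * (1 / (cmod (1 - complex_of_real r * iexp s))\<^sup>2) \<partial>\<sigma>)"
      proof (rule integral_mono)
        show "integrable \<sigma> (\<lambda>s. (1 - r)\<^sup>2 * (1 / (cmod (1 - complex_of_real r * iexp s))\<^sup>2))"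
          using r by (intro integrable_mult_right integral_abel_kernel(1)) auto
        show "indicator E s \<le> (1 - r)\<^sup>2 * (1 / (cmod (1 - complex_of_real r * iexp s))\<^sup>2)" for s
        proof (cases "s \<in> E")
          case True
          have "cmod (1 - complex_of_real r) = 1 - r"
            using r norm_of_real[of "1 - r", where 'a = complex] by simp
          then show ?thesis
            using True r by (simp add: E_def)
        qed simp
      qed (use E in \<open>intro integrable_const_bound[where B = 1], auto\<close>)
      also have "\<dots> = ((1 - r) * norm (neumann_series (complex_of_real r) g))\<^sup>2"
        unfolding integral_mult_right_zero using integral_abel_kernel(2)[of r] r
        by (simp add: power_mult_distrib)
      also have "\<dots> \<le> (b r)\<^sup>2"
        unfolding b_def using norm_abel_mean_le[of r g x] r by (intro power_mono) auto
      finally show ?thesis .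
    qed
    have "(b \<longlongrightarrow> b 1) (at_left 1)"
      unfolding b_def by (intro tendsto_intros)
    then have "((\<lambda>r. (b r)\<^sup>2) \<longlongrightarrow> (b 1)\<^sup>2) (at_left 1)"
      by (rule tendsto_power)
    moreover have "eventually (\<lambda>r. prob E \<le> (b r)\<^sup>2) (at_left 1)"
      using eventually_at_left_real[of 0 "1::real"] by (rule eventually_mono) (auto intro: le)
    ultimately have "prob E \<le> (b 1)\<^sup>2"
      by (rule tendsto_lowerbound) simp
    also have "\<dots> \<le> e\<^sup>2"
      using x by (intro power_mono) (auto simp: b_def dist_norm norm_minus_commute)
    finally show ?thesis .
  qed
  have "prob E \<le> 0"
  proof (rule field_le_epsilon)
    fix e :: real assume "0 < e"
    then show "prob E \<le> 0 + e"
      using bound[of "sqrt e"] by simp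
  qed
  then have "prob E = 0"
    by (simp add: order_antisym)
  then have "emeasure \<sigma> E = 0"
    by (simp add: emeasure_eq_measure)
  then show ?thesis
    using E by (intro AE_I[of _ _ E]) (auto simp: E_def)
qed

text \<open>Up to a null set the Abel kernels are dominated by 1 / sin^2(s/2) = 1 + cot^2(s/2). A
  finite integral would bound the Neumann series uniformly in r, and \<open>cmod_cinner_U_le\<close>
  would contradict \<open>unbounded\<close>.\<close>

lemma infinite_second_moment:
  assumes AE: "AE s in \<sigma>. iexp s \<noteq> 1"
    and unbounded: "\<nexists>B. \<forall>k. cmod (cinner (U k) g) \<le> B * norm (U k - k)"
  shows "(\<integral>\<^sup>+s. ennreal (1 + (cot (s/2))\<^sup>2) \<partial>\<sigma>) = \<infinity>"
proof (rule ccontr)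
  assume fin: "(\<integral>\<^sup>+s. ennreal (1 + (cot (s/2))\<^sup>2) \<partial>\<sigma>) \<noteq> \<infinity>"
  define B where "B = enn2real (\<integral>\<^sup>+s. ennreal (1 + (cot (s/2))\<^sup>2) \<partial>\<sigma>)"
  have "norm (neumann_series (complex_of_real r) g) \<le> sqrt B" if r: "0 \<le> r" "r < 1" for r
  proof -
    have "ennreal ((norm (neumann_series (complex_of_real r) g))\<^sup>2)
        = (\<integral>\<^sup>+s. ennreal (1 / (cmod (1 - complex_of_real r * iexp s))\<^sup>2) \<partial>\<sigma>)"
      unfolding integral_abel_kernel(2)[OF r, symmetric]
      by (rule nn_integral_eq_integral[symmetric]) (use integral_abel_kernel(1)[OF r] in auto)
    also have "\<dots> \<le> (\<integral>\<^sup>+s. ennreal (1 + (cot (s/2))\<^sup>2) \<partial>\<sigma>)"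
    proof (rule nn_integral_mono_AE)
      \<comment> \<open>The exceptional set has to be excluded: division by zero makes the right
        side equal to 1 there, while the left side is (1 - r)^{-2}.\<close>
      show "AE s in \<sigma>. ennreal (1 / (cmod (1 - complex_of_real r * iexp s))\<^sup>2)
          \<le> ennreal (1 + (cot (s/2))\<^sup>2)"
        using AE
      proof eventually_elim
        fix s assume s: "iexp s \<noteq> 1"
        let ?v = "1 - complex_of_real r * iexp s"
        have "1 - r = cmod (1 - complex_of_real r)"
          using r norm_of_real[of "1 - r", where 'a = complex] by simp
        have v0: "?v \<noteq> 0"
          using r by (intro one_minus_iexp_nonzero) simp
        have "1 - cmod (complex_of_real r * iexp s) \<le> cmod ?v"
          using norm_triangle_ineq2[of 1 "complex_of_real r * iexp s"] by simp
        then have "1 - r \<le> cmod ?v"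
          using r by (simp add: norm_mult)
        \<comment> \<open>Replacing r by 1 costs 1 - r, itself at most \<open>cmod ?v\<close>. The
          resulting factor 2 is absorbed by the 4 in |1 - exp(is)|^2 = 4 sin^2(s/2).\<close>
        moreover have "cmod (1 - iexp s) \<le> cmod ?v + cmod (complex_of_real (r - 1) * iexp s)"
          using norm_triangle_ineq[of ?v "complex_of_real (r - 1) * iexp s"] by (simp add: algebra_simps)
        ultimately have "cmod (1 - iexp s) \<le> 2 * cmod ?v"
          using r unfolding norm_mult norm_of_real norm_exp_i_times by simp
        then have "(cmod (1 - iexp s))\<^sup>2 \<le> (2 * cmod ?v)\<^sup>2"
          by (rule power_mono) simp
        then have le: "(sin (s/2))\<^sup>2 \<le> (cmod ?v)\<^sup>2"
          unfolding norm_one_minus_iexp by (simp add: power_mult_distrib)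
        have sin: "sin (s/2) \<noteq> 0"
          using s iexp_eq_1_iff by blast
        have "1 / (cmod ?v)\<^sup>2 \<le> 1 / (sin (s/2))\<^sup>2"
          using le sin v0 by (intro divide_left_mono mult_pos_pos) simp_all
        also have "\<dots> = 1 + (cot (s/2))\<^sup>2"
          using sin sin_cos_squared_add[of "s/2"] by (simp add: cot_def field_simps)
        finally show "ennreal (1 / (cmod ?v)\<^sup>2) \<le> ennreal (1 + (cot (s/2))\<^sup>2)"
          by (rule ennreal_leI)
      qed
    qed
    also have "\<dots> = ennreal B"
      using fin by (simp add: B_def less_top)
    finally have "(norm (neumann_series (complex_of_real r) g))\<^sup>2 \<le> B"
      by (simp add: B_def ennreal_le_iff)
    then show ?thesis
      by (rule real_le_rsqrt)
  qed
  then have "\<forall>k. cmod (cinner (U k) g) \<le> sqrt B * norm (U k - k)"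
    using cmod_cinner_U_le by blast
  with unbounded show False by blast
qed

lemma integral_representation:
  assumes AE: "AE s in \<sigma>. iexp s \<noteq> 1" and z: "Im z > 0"
  shows "(\<integral>t. 1 / (complex_of_real t - z) - complex_of_real (t / (1 + t\<^sup>2))
      \<partial>density (distr \<sigma> borel (\<lambda>s. cot (s/2))) (\<lambda>t. ennreal (1 + t\<^sup>2)))
    = \<i> * (2 * cinner (neumann_series ((z - \<i>) / (z + \<i>)) g) g - 1)"
proof -
  define w where "w = (z - \<i>) / (z + \<i>)"
  have w: "cmod w < 1"
    unfolding w_def by (rule cayley_disc[OF z])
  define h where "h t = 1 / (complex_of_real t - z) - complex_of_real (t / (1 + t\<^sup>2))" for t :: real
  have [measurable]: "h \<in> borel_measurable borel"
    unfolding h_def by measurable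
  have [measurable]: "(\<lambda>s::real. cot (s/2)) \<in> borel_measurable borel"
    unfolding cot_def by measurable
  have "(\<integral>t. h t \<partial>density (distr \<sigma> borel (\<lambda>s. cot (s/2))) (\<lambda>t. ennreal (1 + t\<^sup>2)))
      = (\<integral>t. (1 + t\<^sup>2) *\<^sub>R h t \<partial>distr \<sigma> borel (\<lambda>s. cot (s/2)))"
    by (rule integral_density) auto
  also have "\<dots> = (\<integral>s. (1 + (cot (s/2))\<^sup>2) *\<^sub>R h (cot (s/2)) \<partial>\<sigma>)"
    by (rule integral_distr) auto
  also have "\<dots> = (\<integral>s. \<i> * (2 * (1 / (1 - w * iexp s)) - 1) \<partial>\<sigma>)"
  proof (rule integral_cong_AE)
    show "AE s in \<sigma>. (1 + (cot (s/2))\<^sup>2) *\<^sub>R h (cot (s/2)) = \<i> * (2 * (1 / (1 - w * iexp s)) - 1)"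
      using AE
    proof eventually_elim
      fix s assume "iexp s \<noteq> 1"
      then show "(1 + (cot (s/2))\<^sup>2) *\<^sub>R h (cot (s/2)) = \<i> * (2 * (1 / (1 - w * iexp s)) - 1)"
        unfolding h_def by (intro nevanlinna_kernel_cayley[OF z cayley_cot _ w_def]) auto
    qed
  qed measurable
  also have "\<dots> = \<i> * (2 * (\<integral>s. 1 / (1 - w * iexp s) \<partial>\<sigma>) - 1)"
  proof -
    have "(\<integral>s. 2 * (1 / (1 - w * iexp s)) - 1 \<partial>\<sigma>)
        = (\<integral>s. 2 * (1 / (1 - w * iexp s)) \<partial>\<sigma>) - (\<integral>s. 1 \<partial>\<sigma>)"
      using generating_function(1)[OF w]
      by (intro Bochner_Integration.integral_diff integrable_mult_right) auto
    then show ?thesis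
      unfolding integral_mult_right_zero by (simp add: prob_space[simplified])
  qed
  finally show ?thesis
    unfolding h_def w_def generating_function(2)[OF w, unfolded w_def] .
qed

end

section \<open>From an isometry to the Donoghue class\<close>

context linear_isometry
begin

lemma holomorphic_neumann_series:
  "(\<lambda>w. cinner (neumann_series w x) y) holomorphic_on ball 0 1"
proof -
  define c where "c n = cinner ((U ^^ n) x) y" for n
  have sums: "(\<lambda>n. c n * w ^ n) sums cinner (neumann_series w x) y" if "w \<in> ball 0 1" for w
    using cinner_neumann_series_sums[of w x y] that by (simp add: c_def mult.commute)
  have "(\<lambda>w. \<Sum>n. c n * w ^ n) holomorphic_on ball 0 1"
  proof (rule holomorphic_onI)
    fix w :: complex assume "w \<in> ball 0 1"
    then obtain \<rho> where \<rho>: "cmod w < \<rho>" "\<rho> < 1"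
      using dense[of "cmod w" 1] by auto
    then have "0 < \<rho>"
      using norm_ge_zero[of w] by linarith
    with \<rho> have "complex_of_real \<rho> \<in> ball 0 1"
      by simp
    then have "summable (\<lambda>n. c n * complex_of_real \<rho> ^ n)"
      by (rule sums_summable[OF sums])
    moreover have "cmod w < cmod (complex_of_real \<rho>)"
      using \<rho> \<open>0 < \<rho>\<close> by simp
    ultimately have "DERIV (\<lambda>w. \<Sum>n. c n * w ^ n) w :> (\<Sum>n. diffs c n * w ^ n)"
      by (rule termdiffs_strong)
    then show "(\<lambda>w. \<Sum>n. c n * w ^ n) field_differentiable at w within ball 0 1"
      unfolding field_differentiable_def by (intro exI) (rule has_field_derivative_at_within)
  qed
  then show ?thesis
    by (rule holomorphic_transform) (rule sums_unique[OF sums, symmetric])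
qed

text \<open>The assumed V is a Herglotz integral in the variable w. \<open>dense\<close> rules out
  an atom at exp(is) = 1, where the kernel is z itself and has no counterpart on the real line;
  \<open>unbounded\<close> rules out finite mass.\<close>

theorem donoghue_class_of_isometry:
  assumes g: "norm g = 1" and dense: "g \<in> closure (range (\<lambda>x. U x - x))"
    and unbounded: "\<nexists>B. \<forall>k. cmod (cinner (U k) g) \<le> B * norm (U k - k)"
    and V: "\<And>z. Im z > 0 \<Longrightarrow> V z = \<i> * (2 * cinner (neumann_series ((z - \<i>) / (z + \<i>)) g) g - 1)"
  shows "V \<in> donoghue_class"
proof -
  obtain \<sigma> where \<sigma>: "real_distribution \<sigma>" "\<And>n. char \<sigma> (real n) = cinner ((U ^^ n) g) g"
    using trigonometric_moments[OF g] by auto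
  interpret isometry_moments U g \<sigma>
    by (intro isometry_moments.intro isometry_moments_axioms.intro linear_isometry_axioms \<sigma> g)
  note AE = AE_iexp_neq_1[OF dense]
  \<comment> \<open>With the weight 1 + t^2 the normalising integral becomes the total mass of
    \<sigma>, and the total mass of \<mu> becomes the integral of 1 + cot^2(s/2).\<close>
  define \<mu> where "\<mu> = density (distr \<sigma> borel (\<lambda>s. cot (s/2))) (\<lambda>t. ennreal (1 + t\<^sup>2))"
  have [measurable]: "(\<lambda>s::real. cot (s/2)) \<in> borel_measurable borel"
    unfolding cot_def by measurable
  have H: "upper_half_plane = {z. Im z > 0}" "open upper_half_plane"
    by (simp_all add: upper_half_plane_def open_halfspace_Im_gt)
  have zi: "z + \<i> \<noteq> 0" if "Im z > 0" for z
    using that by (auto simp: complex_eq_iff)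
  have "V analytic_on upper_half_plane"
  proof -
    have "(\<lambda>z. (z - \<i>) / (z + \<i>)) holomorphic_on upper_half_plane"
      by (intro holomorphic_intros) (simp add: H(1) zi)
    moreover have "(\<lambda>z. (z - \<i>) / (z + \<i>)) ` upper_half_plane \<subseteq> ball 0 1"
      unfolding H(1) by (intro image_subsetI) (simp only: mem_Collect_eq mem_ball_0 cayley_disc)
    ultimately have "(\<lambda>w. cinner (neumann_series w g) g) \<circ> (\<lambda>z. (z - \<i>) / (z + \<i>))
        holomorphic_on upper_half_plane"
      by (intro holomorphic_on_compose_gen[OF _ holomorphic_neumann_series])
    then have "(\<lambda>z. cinner (neumann_series ((z - \<i>) / (z + \<i>)) g) g) holomorphic_on upper_half_plane"
      by (simp only: comp_def)
    then have "(\<lambda>z. \<i> * (2 * cinner (neumann_series ((z - \<i>) / (z + \<i>)) g) g - 1)) holomorphic_on upper_half_plane"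
      by (intro holomorphic_intros)
    then have "V holomorphic_on upper_half_plane"
      by (rule holomorphic_transform) (simp add: V H(1))
    then show ?thesis
      by (simp add: analytic_on_open H(2))
  qed
  moreover have "Im (V z) > 0" if z: "Im z > 0" for z
  proof -
    define w where "w = (z - \<i>) / (z + \<i>)"
    have w: "cmod w < 1"
      unfolding w_def by (rule cayley_disc[OF z])
    have "neumann_series w g \<noteq> 0"
    proof
      assume "neumann_series w g = 0"
      moreover have "U 0 = 0"
        using norm_U[of 0] by simp
      ultimately have "g = 0"
        using neumann_series_eq[OF w, of g] by simp
      with g show False by simp
    qed
    \<comment> \<open>By \<open>norm_neumann_series\<close> this quantity is the imaginary part of
      \<open>V z\<close>.\<close>
    then have "0 < (1 - (cmod w)\<^sup>2) * (norm (neumann_series w g))\<^sup>2"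
      using w by (intro mult_pos_pos) (simp_all add: power_less_one_iff)
    then show ?thesis
      unfolding V[OF z] norm_neumann_series[OF w] w_def[symmetric] by (simp add: g)
  qed
  moreover have "sets \<mu> = sets borel"
    by (simp add: \<mu>_def)
  moreover have "emeasure \<mu> UNIV = \<infinity>"
    using infinite_second_moment[OF AE unbounded]
    by (simp add: \<mu>_def emeasure_density nn_integral_distr)
  moreover have "(\<integral>\<^sup>+t. ennreal (1 / (1 + t\<^sup>2)) \<partial>\<mu>) = ennreal 1"
  proof -
    have "ennreal (1 + t\<^sup>2) * ennreal (1 / (1 + t\<^sup>2)) = 1" for t :: real
    proof -
      have "1 + t\<^sup>2 \<noteq> 0"
        using zero_le_power2[of t] by linarith
      then have "ennreal ((1 + t\<^sup>2) * (1 / (1 + t\<^sup>2))) = 1"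
        by simp
      then show ?thesis
        by (subst (asm) ennreal_mult) auto
    qed
    then have "(\<integral>\<^sup>+t. ennreal (1 / (1 + t\<^sup>2)) \<partial>\<mu>) = (\<integral>\<^sup>+t. 1 \<partial>distr \<sigma> borel (\<lambda>s. cot (s/2)))"
      unfolding \<mu>_def by (subst nn_integral_density) auto
    also have "\<dots> = 1"
      by (subst nn_integral_distr) (auto simp: emeasure_space_1[simplified])
    finally show ?thesis by simp
  qed
  moreover have "V z = (\<integral>t. 1 / (complex_of_real t - z) - complex_of_real (t / (1 + t\<^sup>2)) \<partial>\<mu>)"
    if "Im z > 0" for z
    unfolding \<mu>_def integral_representation[OF AE that] by (rule V[OF that])
  ultimately show ?thesis
    unfolding donoghue_class_def donoghue_class_kappa_def mem_Collect_eq
    by (intro conjI exI[of _ \<mu>]) (auto simp: H(1))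
qed

end

section \<open>The impedance function\<close>

text \<open>With R the resolvent of A at i, U = 1 + 2 i R. The second conjunct parametrises elements
  of the graph of A by x = f' - i f.\<close>

lemma cayley_transform:
  assumes A: "selfadjoint A"
  shows "\<exists>U. linear_isometry U \<and>
    (\<forall>x. ((1 / (2 * \<i>)) *\<^sub>C (U x - x), (1/2) *\<^sub>C (U x + x)) \<in> A) \<and>
    (\<forall>f f'. (f, f') \<in> A \<longrightarrow> U (f' - \<i> *\<^sub>C f) = f' + \<i> *\<^sub>C f)"
proof -
  obtain R where R: "\<And>x. (R x, x + \<i> *\<^sub>C R x) \<in> A"
    using selfadjoint_minus_ii_surj[OF A] by metis
  define U where "U x = x + (2 * \<i>) *\<^sub>C R x" for x
  have R_eq: "R (f' - \<i> *\<^sub>C f) = f" if "(f, f') \<in> A" for f f'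
  proof -
    have "(R (f' - \<i> *\<^sub>C f) - f, \<i> *\<^sub>C (R (f' - \<i> *\<^sub>C f) - f)) \<in> A"
      using linear_operator_diff[OF selfadjoint_linear[OF A] R[of "f' - \<i> *\<^sub>C f"] that]
      by (simp add: complex_vector.scale_right_diff_distrib algebra_simps)
    then have "R (f' - \<i> *\<^sub>C f) - f = 0"
      by (rule selfadjoint_eigenvector_zero[OF A]) simp
    then show ?thesis by simp
  qed
  have "linear_isometry U"
  proof
    fix x y c
    have "R (x + y) = R x + R y"
      using R_eq[OF linear_operator_add[OF selfadjoint_linear[OF A] R R, of x y]]
      by (simp add: scaleC_add_right algebra_simps)
    then show "U (x + y) = U x + U y"
      by (simp add: U_def scaleC_add_right)
    have "R (c *\<^sub>C x) = c *\<^sub>C R x"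
      using R_eq[OF linear_operator_scaleC[OF selfadjoint_linear[OF A] R, of c x]]
      by (simp add: scaleC_add_right scaleC_scaleC mult.commute)
    then show "U (c *\<^sub>C x) = c *\<^sub>C U x"
      by (simp add: U_def scaleC_add_right scaleC_scaleC mult.commute)
    have "(norm (x + \<i> *\<^sub>C R x + \<i> *\<^sub>C R x))\<^sup>2 = (norm (x + \<i> *\<^sub>C R x + (- \<i>) *\<^sub>C R x))\<^sup>2"
      using selfadjoint_shift_norm[OF A R] by metis
    moreover have "x + \<i> *\<^sub>C R x + \<i> *\<^sub>C R x = U x"
      by (simp add: U_def add.assoc scaleC_add_left[symmetric])
    ultimately show "norm (U x) = norm x"
      by (simp add: complex_vector.scale_minus_left)
  qed
  moreover have "((1 / (2 * \<i>)) *\<^sub>C (U x - x), (1/2) *\<^sub>C (U x + x)) \<in> A" for x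
  proof -
    have "(1 / (2 * \<i>)) *\<^sub>C (U x - x) = R x"
      by (simp add: U_def scaleC_scaleC)
    moreover have "(1/2) *\<^sub>C (U x + x) = x + \<i> *\<^sub>C R x"
    proof -
      have "U x + x = (2::complex) *\<^sub>C x + (2 * \<i>) *\<^sub>C R x"
        using scaleC_add_left[of 1 1 x] by (simp add: U_def)
      then show ?thesis
        by (simp add: scaleC_add_right scaleC_scaleC)
    qed
    ultimately show "((1 / (2 * \<i>)) *\<^sub>C (U x - x), (1/2) *\<^sub>C (U x + x)) \<in> A"
      using R by simp
  qed
  moreover have "U (f' - \<i> *\<^sub>C f) = f' + \<i> *\<^sub>C f" if "(f, f') \<in> A" for f f'
    using scaleC_add_left[of \<i> \<i> f] by (simp add: U_def R_eq[OF that])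
  ultimately show ?thesis by blast
qed

text \<open>The vector h in the last assumption is (Q - z)^{-1} g. Its existence is not presupposed:
  the proof constructs it from the Neumann series of the Cayley transform.\<close>

lemma donoghue_class_of_selfadjoint:
  assumes sa: "selfadjoint Q" and g: "norm g = 1"
    and unbounded: "\<And>B. \<exists>(f, f')\<in>Q. B * norm f < cmod (cinner f' g - cinner f (\<i> *\<^sub>C g))"
    and V: "\<And>z h. Im z > 0 \<Longrightarrow> (h, g + z *\<^sub>C h) \<in> Q \<Longrightarrow> V z = z + (z\<^sup>2 + 1) * cinner h g"
  shows "V \<in> donoghue_class"
proof -
  obtain U where "linear_isometry U"
    and "\<forall>x. ((1 / (2 * \<i>)) *\<^sub>C (U x - x), (1/2) *\<^sub>C (U x + x)) \<in> Q"
    and "\<forall>f f'. (f, f') \<in> Q \<longrightarrow> U (f' - \<i> *\<^sub>C f) = f' + \<i> *\<^sub>C f"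
    using cayley_transform[OF sa] by blast
  then have inQ: "((1 / (2 * \<i>)) *\<^sub>C (U x - x), (1/2) *\<^sub>C (U x + x)) \<in> Q"
    and UQ: "(f, f') \<in> Q \<Longrightarrow> U (f' - \<i> *\<^sub>C f) = f' + \<i> *\<^sub>C f" for x f f'
    by blast+
  interpret linear_isometry U by fact
  have UQ_diff: "U (f' - \<i> *\<^sub>C f) - (f' - \<i> *\<^sub>C f) = (2 * \<i>) *\<^sub>C f" if "(f, f') \<in> Q" for f f'
    using scaleC_add_left[of \<i> \<i> f] by (simp add: UQ[OF that])
  show ?thesis
  proof (rule donoghue_class_of_isometry[OF g])
    have "Domain Q \<subseteq> range (\<lambda>x. U x - x)"
    proof
      fix f assume "f \<in> Domain Q"
      then obtain f' where f': "(f, f') \<in> Q" by blast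
      let ?k = "f' - \<i> *\<^sub>C f"
      have "U ((1 / (2 * \<i>)) *\<^sub>C ?k) - (1 / (2 * \<i>)) *\<^sub>C ?k = (1 / (2 * \<i>)) *\<^sub>C (U ?k - ?k)"
        unfolding U_scaleC by (rule complex_vector.scale_right_diff_distrib[symmetric])
      also have "\<dots> = f"
        unfolding UQ_diff[OF f'] by (simp add: scaleC_scaleC)
      finally show "f \<in> range (\<lambda>x. U x - x)"
        by (intro range_eqI) (rule sym)
    qed
    from closure_mono[OF this] show "g \<in> closure (range (\<lambda>x. U x - x))"
      using sa by (auto simp: selfadjoint_def densely_defined_def)
    show "\<nexists>B. \<forall>k. cmod (cinner (U k) g) \<le> B * norm (U k - k)"
    proof
      assume "\<exists>B. \<forall>k. cmod (cinner (U k) g) \<le> B * norm (U k - k)"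
      then obtain B where B: "\<And>k. cmod (cinner (U k) g) \<le> B * norm (U k - k)" by blast
      \<comment> \<open>The boundary form at f is (U k, g) with k = f' - i f, and U k - k = 2 i f;
        hence the constant 2 B.\<close>
      obtain f f' where f: "(f, f') \<in> Q"
        "2 * B * norm f < cmod (cinner f' g - cinner f (\<i> *\<^sub>C g))"
        using unbounded[of "2 * B"] by blast
      have "cinner f' g - cinner f (\<i> *\<^sub>C g) = cinner (U (f' - \<i> *\<^sub>C f)) g"
        by (simp add: UQ[OF f(1)] cinner_linear)
      moreover have "norm ((2 * \<i>) *\<^sub>C f) = 2 * norm f"
        by (simp add: norm_scaleC norm_mult)
      ultimately show False
        using B[of "f' - \<i> *\<^sub>C f"] f(2) unfolding UQ_diff[OF f(1)] by simp
    qed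
    fix z :: complex assume z: "Im z > 0"
    define w where "w = (z - \<i>) / (z + \<i>)"
    have w: "cmod w < 1"
      unfolding w_def by (rule cayley_disc[OF z])
    have zi: "z + \<i> \<noteq> 0"
      using z by (auto simp: complex_eq_iff)
    define n where "n = neumann_series w g"
    \<comment> \<open>In the parametrisation of the graph by k, the equation (Q - z) h = g reads (z
      + i) / (2 i) (k - w U k) = g, so k = c n.\<close>
    define c where "c = 2 * (\<i> / (z + \<i>))"
    have c: "c / 2 = \<i> / (z + \<i>)"
      unfolding c_def by (rule nonzero_mult_div_cancel_left) simp
    define h where "h = (1 / (2 * \<i>)) *\<^sub>C (U (c *\<^sub>C n) - c *\<^sub>C n)"
    have n: "n - w *\<^sub>C U n = g"
      unfolding n_def by (rule neumann_series_eq[OF w])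
    have h: "h = (1 / (z + \<i>)) *\<^sub>C U n - (1 / (z + \<i>)) *\<^sub>C n"
      by (simp add: h_def U_scaleC scaleC_scaleC complex_vector.scale_right_diff_distrib c_def)
    have "(1/2) *\<^sub>C (U (c *\<^sub>C n) + c *\<^sub>C n) = g + z *\<^sub>C h"
    proof -
      have "g + z *\<^sub>C h = (1 - z / (z + \<i>)) *\<^sub>C n + (z / (z + \<i>) - w) *\<^sub>C U n"
        unfolding h n[symmetric]
        by (simp add: scaleC_scaleC complex_vector.scale_right_diff_distrib
            complex_vector.scale_left_diff_distrib)
      also have "1 - z / (z + \<i>) = (z + \<i>) / (z + \<i>) - z / (z + \<i>)"
        using zi by simp
      also have "\<dots> = c / 2"
        unfolding diff_divide_distrib[symmetric] c by simp
      also have "z / (z + \<i>) - w = c / 2"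
        unfolding w_def diff_divide_distrib[symmetric] c by simp
      finally show ?thesis
        by (simp add: U_scaleC scaleC_add_right scaleC_scaleC)
    qed
    then have "(h, g + z *\<^sub>C h) \<in> Q"
      using inQ[of "c *\<^sub>C n"] by (simp add: h_def)
    then have "V z = z + (z\<^sup>2 + 1) * cinner h g"
      by (rule V[OF z])
    also have "\<dots> = \<i> * (2 * cinner n g - 1)"
    proof -
      have "cinner n g - w * cinner (U n) g = 1"
        using arg_cong[OF n, of "\<lambda>x. cinner x g"] by (simp add: cinner_linear cinner_self g)
      moreover have "w * (z + \<i>) = z - \<i>"
        using zi by (simp add: w_def)
      moreover have "cinner h g * (z + \<i>) = cinner (U n) g - cinner n g"
      proof -
        have "cinner h g = (cinner (U n) g - cinner n g) / (z + \<i>)"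
          unfolding h by (simp add: cinner_linear diff_divide_distrib)
        then show ?thesis
          using zi by simp
      qed
      ultimately show ?thesis
        using i_squared by algebra
    qed
    finally show "V z = \<i> * (2 * cinner (neumann_series ((z - \<i>) / (z + \<i>)) g) g - 1)"
      by (simp only: n_def w_def)
  qed
qed

section \<open>The channel vector and the impedance under Hypothesis I\<close>

locale lsystem_hypothesis_I =
  fixes \<Theta> :: "'a::chilbert_space lsystem" and gp gm :: 'a and \<kappa> :: real
  assumes L_system: "L_system \<Theta>" and hypothesis: "hypothesis_I_data \<Theta> gp gm \<kappa>"
begin

abbreviation "A \<equiv> sym_op \<Theta>"
abbreviation "S \<equiv> state_op \<Theta>"
abbreviation "D \<equiv> pos_space A"
abbreviation "Q \<equiv> quasi_kernel A S"
abbreviation "\<phi> \<equiv> channel_op \<Theta> 1"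

lemma dense_A: "densely_defined A" and A_symmetric: "A \<subseteq> adj A"
  using L_system by (auto simp: L_system_def symmetric_operator_def)

lemma linear_adj_A: "linear_operator (adj A)"
  by (rule linear_operator_adj[OF dense_A])

lemma D_iff: "f \<in> D \<longleftrightarrow> (\<exists>f'. (f, f') \<in> adj A)"
  by (auto simp: pos_space_def)

lemma D_add: "f \<in> D \<Longrightarrow> g \<in> D \<Longrightarrow> f + g \<in> D"
  unfolding D_iff using linear_operator_add[OF linear_adj_A] by blast

lemma D_scaleC: "f \<in> D \<Longrightarrow> c *\<^sub>C f \<in> D"
  unfolding D_iff using linear_operator_scaleC[OF linear_adj_A] by blast

lemma star_ext: "star_extension A (main_op \<Theta>) S"
  using L_system by (simp add: L_system_def)

lemma selfadjoint_Q: "selfadjoint Q"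
  using star_ext by (simp add: star_extension_def)

lemma bounded_S: "rig_bounded A S"
  using star_ext by (simp add: star_extension_def)

lemma S_neg_space: "f \<in> D \<Longrightarrow> S f \<in> neg_space A"
  using bounded_S by (simp add: rig_bounded_def)

lemma S_add: "f \<in> D \<Longrightarrow> g \<in> D \<Longrightarrow> S (f + g) h = S f h + S g h"
  using bounded_S unfolding rig_bounded_def by metis

lemma S_scaleC: "f \<in> D \<Longrightarrow> S (c *\<^sub>C f) h = c * S f h"
  using bounded_S unfolding rig_bounded_def by metis

lemma neg_space_add: "\<psi> \<in> neg_space A \<Longrightarrow> f \<in> D \<Longrightarrow> g \<in> D \<Longrightarrow> \<psi> (f + g) = \<psi> f + \<psi> g"
  and neg_space_scaleC: "\<psi> \<in> neg_space A \<Longrightarrow> f \<in> D \<Longrightarrow> \<psi> (c *\<^sub>C f) = cnj c * \<psi> f"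
  and neg_space_outside: "\<psi> \<in> neg_space A \<Longrightarrow> f \<notin> D \<Longrightarrow> \<psi> f = 0"
  unfolding neg_space_def by blast+

lemma channel_bdd: "channel_bounded A (channel_op \<Theta>)"
  using L_system by (simp add: L_system_def)

lemma \<phi>_neg_space: "\<phi> \<in> neg_space A"
  using channel_bdd unfolding channel_bounded_def by blast

lemmas \<phi>_add = neg_space_add[OF \<phi>_neg_space]
lemmas \<phi>_scaleC = neg_space_scaleC[OF \<phi>_neg_space]

text \<open>The real part read as a Hermitian form on \<open>D\<close>; equations in the negative
  space become identities tested against all g in \<open>D\<close>.\<close>

definition R :: "'a \<Rightarrow> 'a \<Rightarrow> complex" where
  "R f g = rig_Re A S f g"

lemma R_eq: "f \<in> D \<Longrightarrow> R f g = (if g \<in> D then (S f g + cnj (S g f)) / 2 else 0)"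
  by (simp add: R_def rig_Re_def rig_adj_def neg_space_outside[OF S_neg_space])

lemma R_hermitian: "f \<in> D \<Longrightarrow> g \<in> D \<Longrightarrow> R f g = cnj (R g f)"
  by (simp add: R_eq)

lemma R_add: "f \<in> D \<Longrightarrow> g \<in> D \<Longrightarrow> R (f + g) h = R f h + R g h"
  by (simp add: R_eq D_add S_add neg_space_add[OF S_neg_space] add_divide_distrib)

lemma R_scaleC: "f \<in> D \<Longrightarrow> R (c *\<^sub>C f) h = c * R f h"
  by (simp add: R_eq D_scaleC S_scaleC neg_space_scaleC[OF S_neg_space] distrib_left)

text \<open>Real part plus i times the rank-one imaginary part. The factor (f, \<phi>) appears as
  \<open>cnj (\<phi> f)\<close> because functionals are conjugate-linear.\<close>

lemma S_eq:
  assumes "f \<in> D" "g \<in> D"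
  shows "S f g = R f g + \<i> * cnj (\<phi> f) * \<phi> g"
proof -
  have "rig_Im A S f = channel_op \<Theta> (channel_adj (channel_op \<Theta>) f)"
    using L_system assms(1) by (simp add: L_system_def)
  then have "rig_Im A S f g = cnj (\<phi> f) * \<phi> g"
    using channel_adj_adjoint[OF channel_bdd, of "cnj (\<phi> f)" g] by (simp add: channel_adj_def)
  then have "S f g - cnj (S g f) = 2 * \<i> * (cnj (\<phi> f) * \<phi> g)"
    using assms by (simp add: rig_Im_def rig_adj_def field_simps)
  then show ?thesis
    using assms by (simp add: R_eq field_simps)
qed

lemma Q_iff: "(f, h) \<in> Q \<longleftrightarrow> f \<in> D \<and> (\<forall>g\<in>D. R f g = cinner h g)"
  by (auto simp: quasi_kernel_def fun_eq_iff embed_def R_eq simp flip: R_def)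

lemma A_subset_Q: "A \<subseteq> Q"
proof
  fix p assume p: "p \<in> A"
  obtain f f' where ff: "p = (f, f')" by (cases p)
  have "S f = embed A f'" "rig_adj A S f = embed A f'" "f \<in> D"
    using star_ext p unfolding ff star_extension_def rig_extends_def by blast+
  then show "p \<in> Q"
    by (simp add: ff quasi_kernel_def rig_Re_def)
qed

lemma Q_subset_adj: "Q \<subseteq> adj A"
  using adj_antimono[OF A_subset_Q] selfadjoint_Q by (simp add: selfadjoint_def)

lemma gp: "(gp, \<i> *\<^sub>C gp) \<in> adj A" and gm: "(gm, (- \<i>) *\<^sub>C gm) \<in> adj A"
  and norm_gp: "norm gp = 1" and norm_gm: "norm gm = 1" and \<kappa>: "0 \<le> \<kappa>" "\<kappa> < 1"
  using hypothesis by (simp_all add: hypothesis_I_data_def op_ker_def)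

lemma gp_self: "cinner gp gp = 1" and gm_self: "cinner gm gm = 1"
  by (simp_all add: cinner_self norm_gp norm_gm)

text \<open>By Hypothesis I, \<open>u\<close> is in the domain of the main operator and \<open>q\<close> in that of \<open>Q\<close>; the
  adjoint of \<open>A\<close> maps them to \<open>u'\<close> and \<open>q'\<close>.\<close>

abbreviation "u \<equiv> gp - complex_of_real \<kappa> *\<^sub>C gm"
abbreviation "u' \<equiv> \<i> *\<^sub>C gp + (complex_of_real \<kappa> * \<i>) *\<^sub>C gm"
abbreviation "q \<equiv> gp - gm"
abbreviation "q' \<equiv> \<i> *\<^sub>C gp + \<i> *\<^sub>C gm"

lemma adj_u: "(u, u') \<in> adj A" and adj_q: "(q, q') \<in> adj A"
  using linear_operator_diff[OF linear_adj_A gp linear_operator_scaleC[OF linear_adj_A gm, of "complex_of_real \<kappa>"]]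
    linear_operator_diff[OF linear_adj_A gp gm]
  by (simp_all add: scaleC_scaleC complex_vector.scale_minus_left)

lemma in_D: "gp \<in> D" "gm \<in> D" "u \<in> D" "q \<in> D"
  using gp gm adj_u adj_q by (auto simp: D_iff)

text \<open>On the domain of the main operator S takes values in H and agrees with the adjoint of
  \<open>A\<close>; removing the imaginary part leaves R.\<close>

lemma R_u:
  assumes "g \<in> D"
  shows "R u g = cinner u' g - \<i> * cnj (\<phi> u) * \<phi> g"
proof -
  have T: "main_op \<Theta> \<subseteq> adj A" "rig_extends A S (main_op \<Theta>)"
    using L_system star_ext by (auto simp: L_system_def Lambda_class_def star_extension_def)
  have "u \<in> Domain (main_op \<Theta>)"
    using hypothesis by (simp add: hypothesis_I_data_def scaleR_scaleC)
  then obtain t where t: "(u, t) \<in> main_op \<Theta>" by blast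
  then have "t = u'"
    using T(1) linear_operator_unique[OF linear_adj_A _ adj_u] by blast
  then have "S u g = cinner u' g"
    using t T(2) assms by (auto simp: rig_extends_def embed_def)
  then show ?thesis
    using S_eq[OF in_D(3) assms] by (simp add: algebra_simps)
qed

lemma Q_q: "(q, q') \<in> Q"
proof -
  have "q \<in> Domain Q"
    using hypothesis by (simp add: hypothesis_I_data_def)
  then obtain t where t: "(q, t) \<in> Q" by blast
  then have "t = q'"
    using Q_subset_adj linear_operator_unique[OF linear_adj_A _ adj_q] by blast
  with t show ?thesis by simp
qed

lemma R_Q: "(h, h') \<in> Q \<Longrightarrow> g \<in> D \<Longrightarrow> R h g = cinner h' g"
  by (simp add: Q_iff)

text \<open>R pairs u with h in two ways, through \<open>R_u\<close> and through Q. Hermitian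
  symmetry equates them and determines \<phi> on the domain of Q up to the constant
  \<open>\<phi> u\<close>.\<close>

lemma \<phi>_Q:
  assumes "(h, h') \<in> Q"
  shows "\<i> * cnj (\<phi> u) * \<phi> h = cinner u' h - cinner u h'"
proof -
  have hD: "h \<in> D"
    using assms by (simp add: Q_iff)
  have "R u h = cnj (cinner h' u)"
    using R_hermitian[OF in_D(3) hD] R_Q[OF assms in_D(3)] by simp
  then show ?thesis
    using R_u[OF hD] by (simp add: cinner_commute[of u h'] algebra_simps)
qed

text \<open>R u u is real, so |\<phi> u|^2 is the imaginary part of (u', u). The overlap x of g_+
  and g_- contributes only to the real part.\<close>

lemma \<phi>_u: "\<phi> u * cnj (\<phi> u) = 1 - (complex_of_real \<kappa>)\<^sup>2"
proof -
  define x where "x = cinner gp gm"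
  have x: "cinner gm gp = cnj x"
    by (simp add: x_def cinner_commute[of gm gp])
  have "cinner u' u = \<i> * (1 - complex_of_real \<kappa> * x + complex_of_real \<kappa> * cnj x - (complex_of_real \<kappa>)\<^sup>2)"
    by (simp add: cinner_linear gp_self gm_self x x_def[symmetric] power2_eq_square algebra_simps)
  then have "Im (cinner u' u) = 1 - \<kappa>\<^sup>2"
    by (simp flip: of_real_power)
  moreover have "Im (R u u) = 0"
    using arg_cong[OF R_hermitian[OF in_D(3) in_D(3)], of Im] by simp
  moreover have "R u u = cinner u' u - \<i> * (\<phi> u * cnj (\<phi> u))"
    using R_u[OF in_D(3)] by (simp add: mult_ac)
  moreover have "\<phi> u * cnj (\<phi> u) = complex_of_real ((cmod (\<phi> u))\<^sup>2)"
    by (simp only: complex_norm_square)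
  ultimately have "(cmod (\<phi> u))\<^sup>2 = 1 - \<kappa>\<^sup>2"
    by simp
  then show ?thesis
    unfolding complex_norm_square[symmetric] by simp
qed

lemma \<phi>_u_nonzero: "\<phi> u \<noteq> 0"
proof
  assume "\<phi> u = 0"
  then have "(complex_of_real \<kappa>)\<^sup>2 = 1"
    using \<phi>_u by simp
  then have "\<kappa>\<^sup>2 = 1"
    by (metis of_real_1 of_real_eq_iff of_real_power)
  then show False
    using \<kappa> power_less_one_iff[of \<kappa> 2] by simp
qed

lemma \<phi>_q: "cnj (\<phi> u) * \<phi> q = 2 * (1 - complex_of_real \<kappa>)"
proof -
  have "\<i> * (cnj (\<phi> u) * \<phi> q) = cinner u' q - cinner u q'"
    using \<phi>_Q[OF Q_q] by (simp only: mult.assoc)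
  also have "\<dots> = \<i> * (2 * (1 - complex_of_real \<kappa>))"
    by (simp add: cinner_linear gp_self gm_self algebra_simps)
  finally show ?thesis by simp
qed

text \<open>Eliminates g_- between u, governed by the main operator, and q, governed by Q; \<kappa>
  < 1 then makes g_+ accessible.\<close>

lemma gp_eq: "(1 - complex_of_real \<kappa>) *\<^sub>C gp = u + (- complex_of_real \<kappa>) *\<^sub>C q"
  by (simp add: complex_vector.scale_left_diff_distrib complex_vector.scale_right_diff_distrib
      complex_vector.scale_minus_left)

lemma one_minus_\<kappa>: "1 - complex_of_real \<kappa> \<noteq> 0" "1 + complex_of_real \<kappa> \<noteq> 0"
  using \<kappa> by (auto simp: complex_eq_iff)

lemma \<phi>_gp: "cnj (\<phi> u) * \<phi> gp = 1 - complex_of_real \<kappa>"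
proof -
  have "(1 - complex_of_real \<kappa>) * \<phi> gp = \<phi> u - complex_of_real \<kappa> * \<phi> q"
    using arg_cong[OF gp_eq, of \<phi>]
    by (simp add: \<phi>_add \<phi>_scaleC in_D D_scaleC del: complex_vector.scale_minus_left)
  then have "(1 - complex_of_real \<kappa>) * (cnj (\<phi> u) * \<phi> gp)
      = \<phi> u * cnj (\<phi> u) - complex_of_real \<kappa> * (cnj (\<phi> u) * \<phi> q)"
    by algebra
  also have "\<dots> = (1 - complex_of_real \<kappa>) * (1 - complex_of_real \<kappa>)"
    unfolding \<phi>_u \<phi>_q by (simp add: power2_eq_square algebra_simps)
  finally show ?thesis
    using one_minus_\<kappa> by simp
qed

text \<open>In operator terms, (Re A - i) g_+ is a multiple of the channel vector: the contributions
  of g_- from u and q cancel.\<close>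

lemma R_gp:
  assumes "g \<in> D"
  shows "(1 - complex_of_real \<kappa>) * (R gp g - \<i> * cinner gp g) = - \<i> * cnj (\<phi> u) * \<phi> g"
proof -
  have "(1 - complex_of_real \<kappa>) * R gp g = R u g - complex_of_real \<kappa> * R q g"
    using arg_cong[OF gp_eq, of "\<lambda>x. R x g"]
    by (simp add: R_add R_scaleC in_D D_scaleC del: complex_vector.scale_minus_left)
  then show ?thesis
    unfolding R_u[OF assms] R_Q[OF Q_q assms] by (simp add: cinner_linear algebra_simps)
qed

text \<open>Re A - z is injective since its kernel consists of eigenvectors of Q with nonreal
  eigenvalue; any solution of the equation is therefore the one chosen by
  \<open>the_inv_into\<close>.\<close>

lemma impedance_eqI:
  assumes z: "Im z \<noteq> 0" and f: "f \<in> D" and eq: "\<And>g. g \<in> D \<Longrightarrow> R f g - z * cinner f g = \<phi> g"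
  shows "impedance \<Theta> z = cnj (\<phi> f)"
proof -
  define P where "P f = (\<lambda>g. rig_Re A S f g - z * embed A f g)" for f
  have P: "P f g = (if g \<in> D then R f g - z * cinner f g else 0)" if "f \<in> D" for f g
    using R_eq[OF that, of g] by (simp add: P_def embed_def R_def)
  have "inj_on P D"
  proof (rule inj_onI)
    fix x y assume xy: "x \<in> D" "y \<in> D" and eq: "P x = P y"
    have d: "x + (-1) *\<^sub>C y \<in> D"
      by (intro D_add D_scaleC xy)
    have "R (x + (-1) *\<^sub>C y) g = cinner (z *\<^sub>C (x + (-1) *\<^sub>C y)) g" if g: "g \<in> D" for g
      using fun_cong[OF eq, of g] g
      by (simp only: R_add R_scaleC D_scaleC xy P if_True cinner_linear) (simp add: algebra_simps)
    then have "(x + (-1) *\<^sub>C y, z *\<^sub>C (x + (-1) *\<^sub>C y)) \<in> Q"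
      using d by (simp only: Q_iff) blast
    then have "x + (-1) *\<^sub>C y = 0"
      by (rule selfadjoint_eigenvector_zero[OF selfadjoint_Q _ z])
    then show "x = y"
      by simp
  qed
  moreover have "P f = \<phi>"
    using P[OF f] eq neg_space_outside[OF \<phi>_neg_space] by (auto simp: fun_eq_iff)
  ultimately have "the_inv_into D P \<phi> = f"
    using f by (rule the_inv_into_f_eq)
  then show ?thesis
    by (simp add: impedance_def Let_def channel_adj_def P_def[abs_def])
qed

theorem impedance_formula:
  assumes z: "Im z > 0" and h: "(h, gp + z *\<^sub>C h) \<in> Q"
  shows "impedance \<Theta> z = complex_of_real ((1 - \<kappa>) / (1 + \<kappa>)) * (z + (z\<^sup>2 + 1) * cinner h gp)"
proof -
  define k where "k = complex_of_real \<kappa>"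
  \<comment> \<open>The reciprocal of the factor in \<open>R_gp\<close>, so that applying Re A - z
    to s (g_+ + (z - i) h) gives exactly \<phi>.\<close>
  define s where "s = \<i> * (1 - k) / cnj (\<phi> u)"
  have hD: "h \<in> D"
    using h by (simp add: Q_iff)
  have fD: "gp + (z - \<i>) *\<^sub>C h \<in> D"
    by (intro D_add D_scaleC in_D hD)
  have "impedance \<Theta> z = cnj (\<phi> (s *\<^sub>C (gp + (z - \<i>) *\<^sub>C h)))"
  proof (rule impedance_eqI)
    fix g assume g: "g \<in> D"
    have "R (s *\<^sub>C (gp + (z - \<i>) *\<^sub>C h)) g - z * cinner (s *\<^sub>C (gp + (z - \<i>) *\<^sub>C h)) g
      = s * (R gp g - \<i> * cinner gp g)"
      by (simp only: R_scaleC R_add D_scaleC fD in_D hD R_Q[OF h g] cinner_add_left cinner_scaleC_left)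
        (simp add: algebra_simps)
    also have "\<dots> = \<phi> g"
    proof -
      have "R gp g - \<i> * cinner gp g = - \<i> * cnj (\<phi> u) * \<phi> g / (1 - k)"
        using R_gp[OF g] one_minus_\<kappa>(1) unfolding k_def by (simp add: field_simps)
      then show ?thesis
        using \<phi>_u_nonzero one_minus_\<kappa>(1) by (simp add: s_def k_def)
    qed
    finally show "R (s *\<^sub>C (gp + (z - \<i>) *\<^sub>C h)) g - z * cinner (s *\<^sub>C (gp + (z - \<i>) *\<^sub>C h)) g = \<phi> g" .
  qed (use z fD D_scaleC in auto)
  also have "\<dots> = s * (cnj (\<phi> gp) + (z - \<i>) * cnj (\<phi> h))"
    by (simp add: \<phi>_scaleC \<phi>_add fD in_D hD D_scaleC)
  finally have V: "impedance \<Theta> z = s * (cnj (\<phi> gp) + (z - \<i>) * cnj (\<phi> h))" .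
  define p where "p = cinner h gp"
  have p: "cinner gp h = cnj p"
    by (simp add: p_def cinner_commute[of gp h])
  \<comment> \<open>Symmetry of Q between q and h removes both unknown products, of g_- with h and
    of g_- with g_+.\<close>
  have "cinner q' h = cinner q (gp + z *\<^sub>C h)"
    by (rule selfadjointD[OF selfadjoint_Q Q_q h])
  moreover have "\<i> * cnj (\<phi> u) * \<phi> h = cinner u' h - cinner u (gp + z *\<^sub>C h)"
    by (rule \<phi>_Q[OF h])
  ultimately have "\<i> * cnj (\<phi> u) * \<phi> h = (1 - k) * ((\<i> - cnj z) * cnj p - 1)"
    by (simp add: cinner_linear gp_self p k_def) algebra
  from arg_cong[OF this, of cnj]
  have h_eq: "- \<i> * (\<phi> u * cnj (\<phi> h)) = (1 - k) * ((- \<i> - z) * p - 1)"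
    by (simp add: k_def mult.assoc)
  have gp_eq: "\<phi> u * cnj (\<phi> gp) = 1 - k"
    using arg_cong[OF \<phi>_gp, of cnj] by (simp add: k_def)
  have s: "s * cnj (\<phi> u) = \<i> * (1 - k)"
    using \<phi>_u_nonzero by (simp add: s_def)
  \<comment> \<open>Only the modulus of \<open>\<phi> u\<close> is known. In this product its phase
    disappears, and 1 - \<kappa>^2 then cancels against (1 - \<kappa>)^2 to give the
    quotient.\<close>
  have "impedance \<Theta> z * (\<phi> u * cnj (\<phi> u)) = (1 - k)\<^sup>2 * (z + (z\<^sup>2 + 1) * p)"
    using V s gp_eq h_eq i_squared by algebra
  moreover have "\<phi> u * cnj (\<phi> u) = 1 - k\<^sup>2"
    unfolding k_def by (rule \<phi>_u)
  ultimately have "(1 - k) * ((1 + k) * impedance \<Theta> z) = (1 - k) * ((1 - k) * (z + (z\<^sup>2 + 1) * p))"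
    by algebra
  then have "(1 + k) * impedance \<Theta> z = (1 - k) * (z + (z\<^sup>2 + 1) * p)"
    using one_minus_\<kappa>(1) by (simp add: k_def)
  then show ?thesis
    using one_minus_\<kappa>(2) by (simp add: k_def p_def field_simps)
qed

corollary impedance_at_ii: "impedance \<Theta> \<i> = \<i> * complex_of_real ((1 - \<kappa>) / (1 + \<kappa>))"
proof -
  obtain h where "(h, gp + \<i> *\<^sub>C h) \<in> Q"
    using selfadjoint_minus_ii_surj[OF selfadjoint_Q] by blast
  then have "impedance \<Theta> \<i> = complex_of_real ((1 - \<kappa>) / (1 + \<kappa>)) * (\<i> + (\<i>\<^sup>2 + 1) * cinner h gp)"
    by (intro impedance_formula) auto
  then show ?thesis by simp
qed

text \<open>The boundary form \<open>(Qf, g\<^sub>+) - (f, \<i> g\<^sub>+)\<close> vanishes on the dense domain of \<open>A\<close> but not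
  at \<open>g\<^sub>+ - g\<^sub>-\<close>.\<close>

lemma boundary_form_unbounded:
  "\<exists>(f, f')\<in>Q. B * norm f < cmod (cinner f' gp - cinner f (\<i> *\<^sub>C gp))"
proof -
  \<comment> \<open>Subtracting from q a vector of the domain of \<open>A\<close> at distance less
    than e leaves the form at 2 i, while B times the norm drops below 1.\<close>
  define e where "e = 1 / (\<bar>B\<bar> + 1)"
  have e: "0 < e" "\<bar>B\<bar> * e < 1"
    by (auto simp: e_def divide_less_eq intro!: divide_pos_pos)
  have "q \<in> closure (Domain A)"
    using dense_A by (simp add: densely_defined_def)
  then obtain d where "d \<in> Domain A" and dist: "dist d q < e"
    using e closure_approachable by blast
  then obtain d' where d: "(d, d') \<in> A" by blast
  have "(q - d, q' - d') \<in> Q"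
    using linear_operator_diff[OF selfadjoint_linear[OF selfadjoint_Q] Q_q] d A_subset_Q by blast
  moreover have "cinner (q' - d') gp - cinner (q - d) (\<i> *\<^sub>C gp) = 2 * \<i>"
    using adjD[OF gp d] by (simp add: cinner_linear gp_self algebra_simps)
  moreover have "B * norm (q - d) < 2"
  proof -
    have "B * norm (q - d) \<le> \<bar>B\<bar> * e"
      using dist by (intro mult_mono) (auto simp: dist_norm norm_minus_commute)
    with e show ?thesis by linarith
  qed
  ultimately show ?thesis
    by (intro bexI[of _ "(q - d, q' - d')"]) (auto simp: norm_mult)
qed

theorem impedance_donoghue:
  assumes "\<kappa> = 0"
  shows "impedance \<Theta> \<in> donoghue_class"
  using selfadjoint_Q norm_gp boundary_form_unbounded
proof (rule donoghue_class_of_selfadjoint)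
  fix z h assume "Im z > 0" "(h, gp + z *\<^sub>C h) \<in> Q"
  then show "impedance \<Theta> z = z + (z\<^sup>2 + 1) * cinner h gp"
    using impedance_formula[of z h] assms by simp
qed

end

section \<open>Coupling\<close>

text \<open>At z = i the kernel collapses to i / (1 + t^2), so the normalisation of the measure is
  the value of M there.\<close>

lemma donoghue_class_at_ii:
  assumes "M \<in> donoghue_class"
  shows "M \<i> = \<i>"
proof -
  obtain \<mu> :: "real measure" where \<mu>: "sets \<mu> = sets borel"
    "(\<integral>\<^sup>+t. ennreal (1 / (1 + t\<^sup>2)) \<partial>\<mu>) = ennreal 1"
    and M: "M \<i> = (\<integral>t. 1 / (complex_of_real t - \<i>) - complex_of_real (t / (1 + t\<^sup>2)) \<partial>\<mu>)"
    using assms unfolding donoghue_class_def donoghue_class_kappa_def upper_half_plane_def by auto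
  have "1 / (complex_of_real t - \<i>) - complex_of_real (t / (1 + t\<^sup>2))
      = \<i> * complex_of_real (1 / (1 + t\<^sup>2))" for t
    by (simp add: complex_eq_iff Re_divide Im_divide power2_eq_square add.commute)
  then have "M \<i> = \<i> * complex_of_real (\<integral>t. 1 / (1 + t\<^sup>2) \<partial>\<mu>)"
    by (simp only: M integral_mult_right_zero integral_complex_of_real)
  also have "(\<integral>t. 1 / (1 + t\<^sup>2) \<partial>\<mu>) = enn2real (\<integral>\<^sup>+t. ennreal (1 / (1 + t\<^sup>2)) \<partial>\<mu>)"
  proof (rule integral_eq_nn_integral)
    have [measurable_cong]: "sets \<mu> = sets borel" by fact
    show "(\<lambda>t. 1 / (1 + t\<^sup>2)) \<in> borel_measurable \<mu>" by measurable
  qed simp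
  also have "\<dots> = 1"
    unfolding \<mu>(2) by simp
  finally show ?thesis by simp
qed

lemma adj_op_sum:
  "(f, f') \<in> adj A \<Longrightarrow> (g, g') \<in> adj B \<Longrightarrow> ((f, g), (f', g')) \<in> adj (op_sum A B)"
  by (fastforce simp: adj_def op_sum_def cinner_prod_def)

lemma op_sum_subset_adj:
  assumes "A \<subseteq> adj A" "B \<subseteq> adj B"
  shows "op_sum A B \<subseteq> adj (op_sum A B)"
proof
  fix p assume "p \<in> op_sum A B"
  then obtain f f' g g' where "p = ((f, g), (f', g'))" "(f, f') \<in> A" "(g, g') \<in> B"
    unfolding op_sum_def by blast
  then show "p \<in> adj (op_sum A B)"
    using adj_op_sum assms by blast
qed

lemma Domain_op_sum: "Domain (op_sum A B) = Domain A \<times> Domain B"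
  unfolding op_sum_def by blast

lemma densely_defined_op_sum:
  "densely_defined A \<Longrightarrow> densely_defined B \<Longrightarrow> densely_defined (op_sum A B)"
  by (simp add: densely_defined_def Domain_op_sum closure_Times)

text \<open>On the domain of \<open>B\<close> the adjoint relation is automatic, so the enlarged
  domain imposes one boundary condition, at v.\<close>

lemma adj_restrict_add_span:
  assumes dense: "densely_defined B" and B: "B \<subseteq> adj B"
    and v: "(v, v') \<in> adj B" and G: "(G, G') \<in> adj B" and form: "cinner v' G = cinner v G'"
  shows "(G, G') \<in> adj (op_restrict (adj B) (add_span (Domain B) v))"
proof -
  note lin = linear_operator_adj[OF dense]
  have "cinner f' G = cinner f G'"
    if f: "(f, f') \<in> op_restrict (adj B) (add_span (Domain B) v)" for f f'
  proof -
    obtain d d' c where d: "(d, d') \<in> B" and f_eq: "f = d + c *\<^sub>C v"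
      using f by (auto simp: op_restrict_def add_span_def complex_vector.span_singleton)
    have "(d + c *\<^sub>C v, d' + c *\<^sub>C v') \<in> adj B"
      using d B v by (intro linear_operator_add[OF lin] linear_operator_scaleC[OF lin]) auto
    moreover have "(d + c *\<^sub>C v, f') \<in> adj B"
      using f f_eq by (simp add: op_restrict_def)
    ultimately have "f' = d' + c *\<^sub>C v'"
      using linear_operator_unique[OF lin] by blast
    then show ?thesis
      using adjD[OF G d] form by (simp add: f_eq cinner_linear)
  qed
  then show ?thesis
    by (auto simp: adj_def)
qed

text \<open>A vanishing first parameter makes the product parameter 0, so \<open>Gp\<close> itself
  spans the domain of the main operator over that of the symmetric one. It also forces sin \<beta> =
  0, so \<open>Gm\<close> has no second component. What remains is the boundary condition at the
  coupling vector.\<close>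

lemma coupling_hypothesis_I:
  fixes \<Theta>1 :: "'a::chilbert_space lsystem" and \<Theta>2 :: "'b::chilbert_space lsystem"
    and \<Theta> :: "('a \<times> 'b) lsystem"
  assumes "lsystem_hypothesis_I \<Theta>1 gp1 gm1 0" "lsystem_hypothesis_I \<Theta>2 gp2 gm2 \<kappa>2"
    and angles: "coupling_angles 0 \<kappa>2 \<alpha> \<beta>"
    and Gp: "Gp = (cos \<alpha> *\<^sub>R gp1, - sin \<alpha> *\<^sub>R gp2)"
    and Gm: "Gm = (cos \<beta> *\<^sub>R gm1, - sin \<beta> *\<^sub>R gm2)"
    and L: "L_system \<Theta>"
    and sym: "sym_op \<Theta> = op_restrict (adj (op_sum (sym_op \<Theta>1) (sym_op \<Theta>2)))
      (add_span (Domain (op_sum (sym_op \<Theta>1) (sym_op \<Theta>2))) (coupling_vector 0 \<kappa>2 \<alpha> gp1 gm1 gp2 gm2))"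
    and main: "main_op \<Theta> = op_restrict (adj (op_sum (sym_op \<Theta>1) (sym_op \<Theta>2)))
      (add_span (Domain (sym_op \<Theta>)) Gp)"
    and quasi: "Gp - Gm \<in> Domain (quasi_kernel (sym_op \<Theta>) (state_op \<Theta>))"
  shows "lsystem_hypothesis_I \<Theta> Gp Gm 0"
proof -
  interpret I1: lsystem_hypothesis_I \<Theta>1 gp1 gm1 0 by fact
  interpret I2: lsystem_hypothesis_I \<Theta>2 gp2 gm2 \<kappa>2 by fact
  define B where "B = op_sum (sym_op \<Theta>1) (sym_op \<Theta>2)"
  have dense: "densely_defined B" and BB: "B \<subseteq> adj B"
    unfolding B_def
    by (intro densely_defined_op_sum op_sum_subset_adj I1.dense_A I2.dense_A I1.A_symmetric I2.A_symmetric)+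
  have sin\<beta>: "sin \<beta> = 0"
    using angles by (auto simp: coupling_angles_def split: if_splits)
  \<comment> \<open>One shape covers both cases of the coupling vector. The condition at
    \<open>Gp\<close> reduces to the relation \<open>ab\<close>; the coefficient c drops out because
    the boundary form between \<open>gm2\<close> and \<open>gp2\<close> is 0.\<close>
  obtain a b c :: complex where
    v: "coupling_vector 0 \<kappa>2 \<alpha> gp1 gm1 gp2 gm2 = (a *\<^sub>C gp1, b *\<^sub>C gp2 + c *\<^sub>C gm2)"
    and ab: "a * cos \<alpha> = b * sin \<alpha>"
  proof (cases "\<kappa>2 = 0")
    case True
    then have "coupling_vector 0 \<kappa>2 \<alpha> gp1 gm1 gp2 gm2 = (1 *\<^sub>C gp1, 0 *\<^sub>C gp2 + (- 1) *\<^sub>C gm2)"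
      by (simp add: coupling_vector_def)
    moreover have "\<alpha> = pi / 2"
      using angles True by (simp add: coupling_angles_def)
    then have "cos \<alpha> = 0"
      by (simp only: cos_pi_half)
    ultimately show ?thesis
      using that[of 1 0 "- 1"] by simp
  next
    case False
    then have "coupling_vector 0 \<kappa>2 \<alpha> gp1 gm1 gp2 gm2 = (complex_of_real (sin \<alpha>) *\<^sub>C gp1,
        complex_of_real (cos \<alpha>) *\<^sub>C gp2 + complex_of_real (- (cos \<alpha> / \<kappa>2)) *\<^sub>C gm2)"
      unfolding scaleR_scaleC[symmetric] by (simp add: coupling_vector_def scaleR_right_diff_distrib)
    then show ?thesis
      by (rule that) (simp add: mult.commute)
  qed
  have adj_v: "((a *\<^sub>C gp1, b *\<^sub>C gp2 + c *\<^sub>C gm2),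
      (a *\<^sub>C \<i> *\<^sub>C gp1, b *\<^sub>C \<i> *\<^sub>C gp2 + c *\<^sub>C (- \<i>) *\<^sub>C gm2)) \<in> adj B"
    unfolding B_def
    by (intro adj_op_sum linear_operator_add linear_operator_scaleC I1.linear_adj_A I2.linear_adj_A
        I1.gp I2.gp I2.gm)
  have Gp_C: "Gp = (complex_of_real (cos \<alpha>) *\<^sub>C gp1, complex_of_real (- sin \<alpha>) *\<^sub>C gp2)"
    by (simp only: Gp scaleR_scaleC)
  have Gm_C: "Gm = (complex_of_real (cos \<beta>) *\<^sub>C gm1, 0)"
    by (simp add: Gm sin\<beta> scaleR_scaleC)
  have adj_Gp: "(Gp, \<i> *\<^sub>C Gp) \<in> adj B"
  proof -
    have "(Gp, (complex_of_real (cos \<alpha>) *\<^sub>C \<i> *\<^sub>C gp1, complex_of_real (- sin \<alpha>) *\<^sub>C \<i> *\<^sub>C gp2)) \<in> adj B"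
      unfolding B_def Gp_C
      by (intro adj_op_sum linear_operator_scaleC I1.linear_adj_A I2.linear_adj_A I1.gp I2.gp)
    then show ?thesis
      by (simp add: Gp_C scaleC_prod_def scaleC_scaleC mult.commute del: of_real_minus)
  qed
  have adj_Gm: "(Gm, (- \<i>) *\<^sub>C Gm) \<in> adj B"
  proof -
    have "(0, 0) \<in> adj (sym_op \<Theta>2)"
      using linear_operator_scaleC[OF I2.linear_adj_A I2.gm, of 0] by simp
    then have "(Gm, (complex_of_real (cos \<beta>) *\<^sub>C (- \<i>) *\<^sub>C gm1, 0)) \<in> adj B"
      unfolding B_def Gm_C
      by (intro adj_op_sum linear_operator_scaleC I1.linear_adj_A I1.gm)
    then show ?thesis
      by (simp only: Gm_C scaleC_prod_def scaleC_scaleC mult.commute fst_conv snd_conv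
          complex_vector.scale_zero_right)
  qed
  have adj_sym: "(G, G') \<in> adj (sym_op \<Theta>)" if "(G, G') \<in> adj B"
    "cinner (a *\<^sub>C \<i> *\<^sub>C gp1, b *\<^sub>C \<i> *\<^sub>C gp2 + c *\<^sub>C (- \<i>) *\<^sub>C gm2) G
      = cinner (a *\<^sub>C gp1, b *\<^sub>C gp2 + c *\<^sub>C gm2) G'" for G G'
    unfolding sym v B_def[symmetric] by (rule adj_restrict_add_span[OF dense BB adj_v that])
  have "Gp \<in> op_ker (adj (sym_op \<Theta>)) \<i>"
    unfolding op_ker_def mem_Collect_eq
  proof (rule adj_sym[OF adj_Gp])
    show "cinner (a *\<^sub>C \<i> *\<^sub>C gp1, b *\<^sub>C \<i> *\<^sub>C gp2 + c *\<^sub>C (- \<i>) *\<^sub>C gm2) Gp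
      = cinner (a *\<^sub>C gp1, b *\<^sub>C gp2 + c *\<^sub>C gm2) (\<i> *\<^sub>C Gp)"
      using ab by (simp add: Gp_C cinner_prod_def scaleC_prod_def cinner_linear I1.gp_self I2.gp_self
          algebra_simps)
  qed
  moreover have "Gm \<in> op_ker (adj (sym_op \<Theta>)) (- \<i>)"
    unfolding op_ker_def mem_Collect_eq
  proof (rule adj_sym[OF adj_Gm])
    show "cinner (a *\<^sub>C \<i> *\<^sub>C gp1, b *\<^sub>C \<i> *\<^sub>C gp2 + c *\<^sub>C (- \<i>) *\<^sub>C gm2) Gm
      = cinner (a *\<^sub>C gp1, b *\<^sub>C gp2 + c *\<^sub>C gm2) ((- \<i>) *\<^sub>C Gm)"
      by (simp add: Gm_C cinner_prod_def scaleC_prod_def cinner_linear)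
  qed
  moreover have "norm Gp = 1" "norm Gm = 1"
    using I1.norm_gp I1.norm_gm I2.norm_gp I2.norm_gm
    by (simp_all add: Gp Gm norm_prod_def power_mult_distrib)
  moreover have "Gp \<in> Domain (main_op \<Theta>)"
  proof -
    have "linear_operator (sym_op \<Theta>)"
      using L by (simp add: L_system_def symmetric_operator_def)
    then have "(0, 0) \<in> sym_op \<Theta>"
      using complex_vector.subspace_0 by (fastforce simp: linear_operator_def zero_prod_def)
    moreover have "Gp \<in> cspan {Gp}"
      by (simp add: complex_vector.span_base)
    ultimately have "Gp \<in> add_span (Domain (sym_op \<Theta>)) Gp"
      unfolding add_span_def by (intro CollectI exI[of _ 0] exI[of _ Gp]) auto
    then show ?thesis
      using adj_Gp unfolding main B_def op_restrict_def by blast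
  qed
  ultimately show ?thesis
    using L quasi by (auto simp: lsystem_hypothesis_I_def hypothesis_I_data_def)
qed

theorem corollary6p6:
  fixes \<Theta>0 :: "'a::chilbert_space lsystem"
    and \<Theta>1 :: "'b::chilbert_space lsystem"
    and \<Theta> :: "('a \<times> 'b) lsystem"
    and \<kappa> :: real
  assumes "L_system \<Theta>0" "minimal_system \<Theta>0" "hypothesis_I \<Theta>0"
    and "L_system \<Theta>1" "minimal_system \<Theta>1" "hypothesis_I \<Theta>1"
    and "is_coupling \<Theta>0 \<Theta>1 \<Theta>"
    and "impedance \<Theta>0 \<in> donoghue_class"
    and "0 \<le> \<kappa>" "\<kappa> < 1"
    and "impedance \<Theta>1 \<in> donoghue_class_kappa \<kappa>"
  shows "impedance \<Theta> \<in> donoghue_class"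
proof -
  from \<open>is_coupling \<Theta>0 \<Theta>1 \<Theta>\<close>
  obtain gp0 gm0 \<kappa>0 gp1 gm1 \<kappa>1 \<alpha> \<beta> Gp Gm where
    data: "hypothesis_I_data \<Theta>0 gp0 gm0 \<kappa>0" "hypothesis_I_data \<Theta>1 gp1 gm1 \<kappa>1"
    and angles: "coupling_angles \<kappa>0 \<kappa>1 \<alpha> \<beta>"
    and G: "Gp = (cos \<alpha> *\<^sub>R gp0, - sin \<alpha> *\<^sub>R gp1)" "Gm = (cos \<beta> *\<^sub>R gm0, - sin \<beta> *\<^sub>R gm1)"
    and L: "L_system \<Theta>"
    and sym: "sym_op \<Theta> = op_restrict (adj (op_sum (sym_op \<Theta>0) (sym_op \<Theta>1)))
      (add_span (Domain (op_sum (sym_op \<Theta>0) (sym_op \<Theta>1)))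
        (coupling_vector \<kappa>0 \<kappa>1 \<alpha> gp0 gm0 gp1 gm1))"
    and main: "main_op \<Theta> = op_restrict (adj (op_sum (sym_op \<Theta>0) (sym_op \<Theta>1)))
      (add_span (Domain (sym_op \<Theta>)) (Gp - (\<kappa>0 * \<kappa>1) *\<^sub>R Gm))"
    and quasi: "Gp - Gm \<in> Domain (quasi_kernel (sym_op \<Theta>) (state_op \<Theta>))"
    unfolding is_coupling_def by (elim exE conjE) (rule that)
  interpret I0: lsystem_hypothesis_I \<Theta>0 gp0 gm0 \<kappa>0
    using assms(1) data(1) by (rule lsystem_hypothesis_I.intro)
  interpret I1: lsystem_hypothesis_I \<Theta>1 gp1 gm1 \<kappa>1
    using assms(4) data(2) by (rule lsystem_hypothesis_I.intro)
  \<comment> \<open>The parameter belongs to whichever vectors the coupling used. The value of the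
    impedance at i, where z^2 + 1 vanishes, determines it regardless of that choice.\<close>
  have "\<kappa>0 = 0"
  proof -
    have "\<i> * complex_of_real ((1 - \<kappa>0) / (1 + \<kappa>0)) = \<i>"
      using I0.impedance_at_ii donoghue_class_at_ii[OF assms(8)] by simp
    from arg_cong[OF this, of Im] have "(1 - \<kappa>0) / (1 + \<kappa>0) = 1"
      unfolding Im_i_times Re_complex_of_real by simp
    then show ?thesis
      using I0.\<kappa> by (simp add: divide_eq_eq split: if_splits)
  qed
  have "lsystem_hypothesis_I \<Theta>0 gp0 gm0 0"
    using I0.lsystem_hypothesis_I_axioms \<open>\<kappa>0 = 0\<close> by simp
  then interpret I: lsystem_hypothesis_I \<Theta> Gp Gm 0
    using angles sym main \<open>\<kappa>0 = 0\<close>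
    by (intro coupling_hypothesis_I[OF _ I1.lsystem_hypothesis_I_axioms _ G L _ _ quasi]) simp_all
  show ?thesis
    by (rule I.impedance_donoghue) simp
qed

end
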